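(* Let $\{q_k : k\in\mathbb{N}\}$ be a non-increasing and convex sequence of non-negative real numbers with $q_0>0$ and $\lim_{n\to\infty}Q_n=\infty$, where $Q_n:=\sum_{k=0}^{n-1}q_k$. Let $\{a_n : n\in\mathbb{P}\}$ be a sequence of positive integers with $\lim_{n\to\infty}a_n=\infty$, and suppose that there is a constant $c>0$ such that \[ c\left(a_n-2^{|a_n|}\right)\log(a_n)\le Q_{a_n}\qquad\text{for all } n\in\mathbb{P}. \] Then for every $f\in L_1(G)$, \[ t_{a_n}(f)\to f \quad\text{almost everywhere on } G \text{ as } n\to\infty . \]
   Context: $\mathbb{P}$ is the set of positive integers and $\mathbb{N}=\mathbb{P}\cup\{0\}$. A sequence $\{q_k\}$ is convex if $2q_{k+1}\le q_k+q_{k+2}$ for all $k\in\mathbb{N}$. For $n\in\mathbb{P}$, $|n|:=[\log_2 n]$ is the integer with $2^{|n|}\le n<2^{|n|+1}$. $G=\prod_{k=0}^\infty \mathbb{Z}_2$ is the dyadic group: its elements are the sequences $x=(x_0,x_1,\dots)$ with $x_k\in\{0,1\}$, with coordinate-wise addition modulo 2, the product topology, and normalized Haar (product) measure $\mu$. "Almost everywhere" and $L_1(G)$ refer to $\mu$. The Rademacher functions are $r_k(x):=(-1)^{x_k}$. For $n=\sum_{k=0}^\infty n_k2^k$ with $n_k\in\{0,1\}$, the Walsh-Paley functions are $w_n(x):=\prod_{k=0}^\infty r_k(x)^{n_k}$ (so $w_0=1$). For $f\in L_1(G)$: $\hat f(k):=\int_G f w_k\,d\mu$ and $S_n(f):=\sum_{k=0}^{n-1}\hat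 f(k)w_k$. The $n$th Nörlund mean ($n\in\mathbb{P}$) defined by $\{q_k\}$ is \[ t_n(f):=\frac1{Q_n}\sum_{k=1}^{n}q_{n-k}S_k(f). \] *)

theory Defs
  imports "HOL-Probability.Probability" "HOL-Library.Z2" "HOL-Library.Discrete_Functions"
begin

type_synonym dyadic = "nat \<Rightarrow> bit"

text \<open>
  Since the two-point factors carry the discrete \<open>\<sigma>\<close>-algebra and there are only countably many
  of them, the product \<open>\<sigma>\<close>-algebra below is the Borel \<open>\<sigma>\<close>-algebra of the product topology.
\<close>

definition dyadic_haar :: "dyadic measure" where
  "dyadic_haar = Pi\<^sub>M UNIV (\<lambda>_. uniform_count_measure (UNIV :: bit set))"

lemma UNIV_bit: "(UNIV :: bit set) = {0, 1}"
  by (auto intro: bit.exhaust)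

lemma prob_space_uniform_bit: "prob_space (uniform_count_measure (UNIV :: bit set))"
  by (rule prob_space_uniform_count_measure) (simp_all add: UNIV_bit)

lemma space_dyadic_haar [simp]: "space dyadic_haar = UNIV"
  by (simp add: dyadic_haar_def space_PiM space_uniform_count_measure)

lemma prob_space_dyadic_haar: "prob_space dyadic_haar"
  unfolding dyadic_haar_def by (intro prob_space_PiM prob_space_uniform_bit)

lemma dyadic_haar_translation_invariant:
  "distr dyadic_haar dyadic_haar (\<lambda>x k. x k + h k) = dyadic_haar"
proof -
  let ?B = "uniform_count_measure (UNIV :: bit set)"
  interpret product_prob_space "\<lambda>_::nat. ?B" UNIV
    unfolding product_prob_space_def product_prob_space_axioms_def product_sigma_finite_def
    using prob_space_uniform_bit by (auto intro: prob_space_imp_sigma_finite)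
  have meas: "(\<lambda>x k. x k + h k) \<in> Pi\<^sub>M UNIV (\<lambda>_. ?B) \<rightarrow>\<^sub>M Pi\<^sub>M UNIV (\<lambda>_. ?B)"
  proof (rule measurable_PiM_single')
    fix k :: nat
    have "(\<lambda>b. b + h k) \<in> ?B \<rightarrow>\<^sub>M ?B"
      by (auto simp: measurable_def space_uniform_count_measure sets_uniform_count_measure)
    then show "(\<lambda>x. x k + h k) \<in> Pi\<^sub>M UNIV (\<lambda>_. ?B) \<rightarrow>\<^sub>M ?B"
      by (intro measurable_compose[OF measurable_component_singleton]) simp_all
  qed (auto simp: space_PiM space_uniform_count_measure)
  have shift: "emeasure ?B ((\<lambda>b. b + c) -` A) = emeasure ?B A" for A and c :: bit
  proof -
    have fin: "finite (UNIV :: bit set)" by (simp add: UNIV_bit)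
    have inv: "b + c + c = b" for b
      by (cases b; cases c) simp_all
    have "inj (\<lambda>b. b + c)" by (rule inj_on_inverseI[of _ "\<lambda>b. b + c"]) (rule inv)
    moreover have "surj (\<lambda>b. b + c)" by (rule surjI[of _ "\<lambda>b. b + c"]) (rule inv)
    ultimately have "card ((\<lambda>b. b + c) -` A) = card A"
      by (intro card_vimage_inj) auto
    then show ?thesis
      by (simp add: emeasure_uniform_count_measure[OF fin])
  qed
  have "Pi\<^sub>M UNIV (\<lambda>_. ?B) = distr (Pi\<^sub>M UNIV (\<lambda>_. ?B)) (Pi\<^sub>M UNIV (\<lambda>_. ?B)) (\<lambda>x k. x k + h k)"
  proof (rule PiM_eq[symmetric])
    fix J :: "nat set" and F
    assume J: "finite J" "J \<subseteq> UNIV" "\<And>j. j \<in> J \<Longrightarrow> F j \<in> sets ?B"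
    have eq: "(\<lambda>x k. x k + h k) -` prod_emb UNIV (\<lambda>_. ?B) J (Pi\<^sub>E J F)
        = prod_emb UNIV (\<lambda>_. ?B) J (\<Pi>\<^sub>E j\<in>J. (\<lambda>b. b + h j) -` F j)"
      by (auto simp: prod_emb_def space_uniform_count_measure PiE_iff)
    show "emeasure (distr (Pi\<^sub>M UNIV (\<lambda>_. ?B)) (Pi\<^sub>M UNIV (\<lambda>_. ?B)) (\<lambda>x k. x k + h k))
        (prod_emb UNIV (\<lambda>_. ?B) J (Pi\<^sub>E J F)) = (\<Prod>j\<in>J. emeasure ?B (F j))"
      using J eq meas
      by (subst emeasure_distr)
        (auto intro!: sets_PiM_I simp: eq space_PiM space_uniform_count_measure
          sets_uniform_count_measure emeasure_PiM_emb shift[simplified])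
  qed simp
  then show ?thesis by (simp add: dyadic_haar_def)
qed

definition rademacher :: "nat \<Rightarrow> dyadic \<Rightarrow> real" where
  "rademacher k x = (if x k = 0 then 1 else -1)"

text \<open>The product over the (finitely many) positions of the binary digits 1 of \<open>n\<close>.\<close>

definition walsh :: "nat \<Rightarrow> dyadic \<Rightarrow> real" where
  "walsh n x = (\<Prod>k | bit n k. rademacher k x)"

definition walsh_coeff :: "(dyadic \<Rightarrow> complex) \<Rightarrow> nat \<Rightarrow> complex" where
  "walsh_coeff f k = (\<integral>x. f x * of_real (walsh k x) \<partial>dyadic_haar)"

definition walsh_partial_sum :: "(dyadic \<Rightarrow> complex) \<Rightarrow> nat \<Rightarrow> dyadic \<Rightarrow> complex" where
  "walsh_partial_sum f n x = (\<Sum>k<n. walsh_coeff f k * of_real (walsh k x))"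

definition norlund_weight :: "(nat \<Rightarrow> real) \<Rightarrow> nat \<Rightarrow> real" where
  "norlund_weight q n = (\<Sum>k<n. q k)"

definition norlund_mean :: "(nat \<Rightarrow> real) \<Rightarrow> (dyadic \<Rightarrow> complex) \<Rightarrow> nat \<Rightarrow> dyadic \<Rightarrow> complex" where
  "norlund_mean q f n x =
     of_real (1 / norlund_weight q n) * (\<Sum>k=1..n. of_real (q (n - k)) * walsh_partial_sum f k x)"

end

theory Submission
  imports Defs
begin

text \<open>
  Write \<open>n = 2\<^sup>m + r\<close> with \<open>r < 2\<^sup>m\<close>. From \<open>D\<^bsub>N+j\<^esub> = D\<^bsub>N\<^esub> + \<rho>\<^sub>m D\<^bsub>j\<^esub>\<close> and
  \<open>D\<^bsub>N-j\<^esub> = D\<^bsub>N\<^esub> - w\<^bsub>N-1\<^esub> D\<^bsub>j\<^esub>\<close>, where \<open>N = 2\<^sup>m\<close> and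
  \<open>\<rho>\<^sub>m\<close> is a Rademacher function, the kernel of the Norlund mean splits into
  \<open>D\<^bsub>N\<^esub>\<close>, a part that summation by parts reduces to Fejer kernels, and a part of size at most
  \<open>q\<^sub>0 r\<close> times the sum of the \<open>D\<close> of order \<open>2\<^sup>i\<close> with \<open>i < m\<close>. The growth hypothesis bounds
  \<open>r m / Q\<^bsub>n\<^esub>\<close>, so the kernel is dominated by \<open>\<Sum>i\<le>m. \<beta>\<^bsub>n,i\<^esub> V\<^bsub>i\<^esub>\<close>, where \<open>V\<^bsub>i\<^esub>\<close> are the positive
  kernels \<open>flip_kernel i\<close> and \<open>\<beta>\<close> is a bounded summation matrix whose columns tend to zero.
  It remains to see that almost every \<open>x\<close> satisfies \<open>(|f - f x| * V\<^bsub>i\<^esub>) x \<longlonglongrightarrow> 0\<close>. This is clear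
  for functions of finitely many coordinates, and passes to \<open>L\<^sub>1\<close> limits by a weak type (1,1)
  inequality for the maximal operator of the \<open>V\<^bsub>i\<^esub>\<close>.
\<close>

section \<open>Walsh kernels\<close>

text \<open>The group operation. Every element is its own inverse, so \<open>bit_add x y\<close> is
  also the difference of x and y, and a convolution kernel K appears below as K applied to
  \<open>bit_add x y\<close>.\<close>

definition bit_add :: "dyadic \<Rightarrow> dyadic \<Rightarrow> dyadic" where
  "bit_add x y = (\<lambda>i. x i + y i)"

definition bit_flip :: "nat \<Rightarrow> dyadic \<Rightarrow> dyadic" where
  "bit_flip j x = x(j := x j + 1)"

definition dirichlet :: "nat \<Rightarrow> dyadic \<Rightarrow> real" where
  "dirichlet n t = (\<Sum>i<n. walsh i t)"

text \<open>The normalized indicator of the cylinder around 0 on which the first m digits vanish.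
  \<open>dirichlet_exp\<close> identifies it with the Dirichlet kernel of order 2^m.\<close>

definition cyl_kernel :: "nat \<Rightarrow> dyadic \<Rightarrow> real" where
  "cyl_kernel m t = (if \<forall>i<m. t i = 0 then 2 ^ m else 0)"

text \<open>A majorant of the Fejer kernel of order \<open>2\<^sup>m\<close>; its term \<open>j = m\<close> is the Dirichlet
  kernel of that order.\<close>

definition flip_kernel :: "nat \<Rightarrow> dyadic \<Rightarrow> real" where
  "flip_kernel m t = (\<Sum>j\<le>m. 2 ^ j / 2 ^ m * cyl_kernel m (bit_flip j t))"

lemma bit_neq_0_iff: "b \<noteq> 0 \<longleftrightarrow> b = (1::bit)"
  by (cases b) auto

lemma bit_add_eq_0_iff: "a + b = 0 \<longleftrightarrow> a = (b::bit)"
  by (cases a; cases b) auto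

lemma cyl_kernel_nonneg: "0 \<le> cyl_kernel m t"
  by (simp add: cyl_kernel_def)

lemma flip_kernel_nonneg: "0 \<le> flip_kernel m t"
  by (auto simp: flip_kernel_def cyl_kernel_nonneg intro!: sum_nonneg)

lemma finite_bits_nat: "finite {k. bit (n::nat) k}"
proof (rule finite_subset)
  show "{k. bit n k} \<subseteq> {..<n}"
  proof
    fix k assume "k \<in> {k. bit n k}"
    then have "odd (n div 2 ^ k)" by (simp add: bit_iff_odd)
    then have "n div 2 ^ k \<noteq> 0" by (metis even_zero)
    then have "2 ^ k \<le> n" by (metis div_less not_le)
    moreover have "k < 2 ^ k" by simp
    ultimately show "k \<in> {..<n}" by (metis lessThan_iff less_le_trans)
  qed
qed simp

lemma walsh_0 [simp]: "walsh 0 t = 1"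
  by (simp add: walsh_def)

text \<open>Digit m of j is 0, so adding 2^m just sets that digit and contributes one more
  Rademacher factor.\<close>

lemma walsh_add_exp:
  assumes "j < 2 ^ m"
  shows "walsh (2 ^ m + j) t = rademacher m t * walsh j t"
proof -
  have nb: "\<not> bit j m" using assms by (simp add: bit_iff_odd)
  then have "2 ^ m + j = set_bit m j" by (simp add: set_bit_eq)
  then have "{k. bit (2 ^ m + j) k} = insert m {k. bit j k}"
    by (auto simp: bit_set_bit_iff)
  then show ?thesis using nb finite_bits_nat[of j] by (simp add: walsh_def)
qed

lemma rademacher_bit_add: "rademacher k (bit_add x y) = rademacher k x * rademacher k y"
  by (cases "x k"; cases "y k") (auto simp: rademacher_def bit_add_def)

lemma walsh_bit_add: "walsh n (bit_add x y) = walsh n x * walsh n y"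
  by (simp add: walsh_def rademacher_bit_add prod.distrib)

lemma rademacher_square: "rademacher k t * rademacher k t = 1"
  by (simp add: rademacher_def)

lemma abs_rademacher: "\<bar>rademacher k t\<bar> = 1"
  by (simp add: rademacher_def)

lemma abs_walsh: "\<bar>walsh n t\<bar> = 1"
  by (simp add: walsh_def abs_prod abs_rademacher)

text \<open>Below position m the digits of 2^m - 1 - i are the complements of those of i, and
  squares of Rademacher functions are 1. The induction splits off the top digit, which belongs
  either to the complement or to i.\<close>

lemma walsh_complement:
  "i < 2 ^ m \<Longrightarrow> walsh (2 ^ m - 1 - i) t = walsh (2 ^ m - 1) t * walsh i t"
proof (induction m arbitrary: i)
  case (Suc m)
  have top: "walsh (2 ^ Suc m - 1) t = rademacher m t * walsh (2 ^ m - 1) t"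
  proof -
    have "(2::nat) ^ Suc m - 1 = 2 ^ m + (2 ^ m - 1)" by simp
    then show ?thesis using walsh_add_exp[of "2 ^ m - 1" m t] by simp
  qed
  show ?case
  proof (cases "i < 2 ^ m")
    case True
    then have "2 ^ Suc m - 1 - i = 2 ^ m + (2 ^ m - 1 - i)" by simp
    then have "walsh (2 ^ Suc m - 1 - i) t = rademacher m t * walsh (2 ^ m - 1 - i) t"
      using walsh_add_exp[of "2 ^ m - 1 - i" m t] by simp
    then show ?thesis using Suc.IH[OF True] top by simp
  next
    case False
    define p where "p = i - 2 ^ m"
    have p: "i = 2 ^ m + p" "p < 2 ^ m" using False Suc.prems by (auto simp: p_def)
    have "2 ^ Suc m - 1 - i = 2 ^ m - 1 - p" using p by simp
    then have "walsh (2 ^ Suc m - 1 - i) t = walsh (2 ^ m - 1) t * walsh p t"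
      using Suc.IH[OF p(2)] by simp
    moreover have "walsh i t = rademacher m t * walsh p t"
      using walsh_add_exp[OF p(2)] p(1) by simp
    ultimately show ?thesis using top rademacher_square[of m t] by (simp add: algebra_simps)
  qed
qed simp

section \<open>Dirichlet kernels\<close>

lemma dirichlet_0 [simp]: "dirichlet 0 t = 0"
  by (simp add: dirichlet_def)

lemma dirichlet_add_exp:
  assumes "j \<le> 2 ^ m"
  shows "dirichlet (2 ^ m + j) t = dirichlet (2 ^ m) t + rademacher m t * dirichlet j t"
  using assms
proof (induction j)
  case (Suc j)
  then show ?case using walsh_add_exp[of j m t] by (simp add: dirichlet_def algebra_simps)
qed simp

text \<open>Paley's formula. Doubling the order multiplies the kernel by 1 +
  \<open>rademacher m t\<close>, which is 2 if digit m vanishes and 0 otherwise.\<close>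

lemma dirichlet_exp: "dirichlet (2 ^ m) t = cyl_kernel m t"
proof (induction m)
  case 0
  then show ?case by (simp add: dirichlet_def cyl_kernel_def)
next
  case (Suc m)
  have "dirichlet (2 ^ Suc m) t = (1 + rademacher m t) * dirichlet (2 ^ m) t"
    using dirichlet_add_exp[of "2 ^ m" m t] by (simp add: mult_2 algebra_simps)
  then show ?case using Suc by (auto simp: cyl_kernel_def rademacher_def less_Suc_eq)
qed

text \<open>By \<open>walsh_complement\<close>, the last j Walsh functions of the block below 2^m
  are the first j ones in reverse order, multiplied by the last function of the block.\<close>

lemma dirichlet_diff_exp:
  assumes "j \<le> 2 ^ m"
  shows "dirichlet (2 ^ m - j) t = dirichlet (2 ^ m) t - walsh (2 ^ m - 1) t * dirichlet j t"
  using assms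
proof (induction j)
  case (Suc j)
  then have "2 ^ m - j = Suc (2 ^ m - Suc j)" by simp
  then have "dirichlet (2 ^ m - j) t = dirichlet (2 ^ m - Suc j) t + walsh (2 ^ m - Suc j) t"
    by (simp add: dirichlet_def)
  moreover have "walsh (2 ^ m - Suc j) t = walsh (2 ^ m - 1) t * walsh j t"
    using walsh_complement[of j m t] Suc.prems by simp
  ultimately show ?case using Suc by (simp add: dirichlet_def algebra_simps)
qed simp

text \<open>Splitting off the leading binary digit of j repeatedly, each digit 1 at position i costs
  one \<open>cyl_kernel i\<close>, and no position occurs twice.\<close>

lemma abs_dirichlet_le:
  "j < 2 ^ m \<Longrightarrow> \<bar>dirichlet j t\<bar> \<le> (\<Sum>i<m. cyl_kernel i t)"
proof (induction m arbitrary: j)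
  case (Suc m)
  show ?case
  proof (cases "j < 2 ^ m")
    case True
    then show ?thesis using Suc.IH[of j] cyl_kernel_nonneg[of m t] by simp
  next
    case False
    define p where "p = j - 2 ^ m"
    have p: "j = 2 ^ m + p" "p < 2 ^ m" using False Suc.prems by (auto simp: p_def)
    have "\<bar>dirichlet j t\<bar> \<le> \<bar>dirichlet (2 ^ m) t\<bar> + \<bar>rademacher m t * dirichlet p t\<bar>"
      using dirichlet_add_exp[of p m t] p by simp
    also have "\<dots> = cyl_kernel m t + \<bar>dirichlet p t\<bar>"
      by (simp add: dirichlet_exp abs_mult abs_rademacher cyl_kernel_nonneg)
    finally show ?thesis using Suc.IH[OF p(2)] by simp
  qed
qed simp

text \<open>This is the term j = m of the majorant: its weight is 1, and flipping digit m is
  invisible to a kernel that reads only the digits below m.\<close>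

lemma cyl_kernel_le_flip_kernel: "cyl_kernel m t \<le> flip_kernel m t"
proof -
  have "cyl_kernel m t = 2 ^ m / 2 ^ m * cyl_kernel m (bit_flip m t)"
    by (auto simp: cyl_kernel_def bit_flip_def)
  also have "\<dots> \<le> flip_kernel m t"
    unfolding flip_kernel_def
    by (rule member_le_sum) (auto simp: cyl_kernel_nonneg)
  finally show ?thesis .
qed

section \<open>Fejer kernels, in unnormalized form\<close>

definition fejer_sum :: "nat \<Rightarrow> dyadic \<Rightarrow> real" where
  "fejer_sum n t = (\<Sum>i=1..n. dirichlet i t)"

lemma fejer_sum_add_exp:
  assumes "p \<le> 2 ^ m"
  shows "fejer_sum (2 ^ m + p) t
    = fejer_sum (2 ^ m) t + real p * cyl_kernel m t + rademacher m t * fejer_sum p t"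
  using assms
proof (induction p)
  case (Suc p)
  have "fejer_sum (2 ^ m + Suc p) t = fejer_sum (2 ^ m + p) t + dirichlet (2 ^ m + Suc p) t"
    by (simp add: fejer_sum_def)
  also have "dirichlet (2 ^ m + Suc p) t = cyl_kernel m t + rademacher m t * dirichlet (Suc p) t"
    using dirichlet_add_exp[of "Suc p" m t] Suc.prems by (simp add: dirichlet_exp)
  finally show ?case using Suc by (simp add: fejer_sum_def algebra_simps)
qed (simp add: fejer_sum_def)

lemma cyl_kernel_Suc: "cyl_kernel (Suc m) t = (1 + rademacher m t) * cyl_kernel m t"
  by (auto simp: cyl_kernel_def rademacher_def less_Suc_eq)

text \<open>Digit m cuts the cylinder of order m into two halves, which the flip of digit m
  exchanges.\<close>

lemma cyl_kernel_split:
  "2 * cyl_kernel m t = cyl_kernel (Suc m) t + cyl_kernel (Suc m) (bit_flip m t)"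
  by (cases "t m") (auto simp: cyl_kernel_def bit_flip_def less_Suc_eq)

text \<open>Doubling the order multiplies the sum by 1 + \<open>rademacher m t\<close> and adds 2^m
  times \<open>cyl_kernel m\<close>. The factor raises the order of each kernel of the majorant by
  one; the added kernel is halved by \<open>cyl_kernel_split\<close>, which creates the term with
  the new flip at m.\<close>

lemma abs_fejer_sum_exp_le: "\<bar>fejer_sum (2 ^ m) t\<bar> \<le> 2 ^ m * flip_kernel m t"
proof (induction m)
  case 0
  then show ?case by (simp add: fejer_sum_def flip_kernel_def cyl_kernel_def dirichlet_def)
next
  case (Suc m)
  have U: "2 ^ m * flip_kernel m t = (\<Sum>j\<le>m. 2 ^ j * cyl_kernel m (bit_flip j t))" for m
    by (simp add: flip_kernel_def sum_distrib_left)
  have rad: "0 \<le> 1 + rademacher m t" by (simp add: rademacher_def)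
  have top: "cyl_kernel k (bit_flip k t) = cyl_kernel k t" for k
    by (simp add: cyl_kernel_def bit_flip_def)
  \<comment> \<open>A flip at j < m leaves digit m alone, so the factor is the same at the flipped
    point. The term j = m is unaffected by its own flip and is treated separately through
    \<open>top\<close>.\<close>
  have low: "(1 + rademacher m t) * cyl_kernel m (bit_flip j t) = cyl_kernel (Suc m) (bit_flip j t)"
    if "j < m" for j
    using that by (simp add: cyl_kernel_Suc rademacher_def bit_flip_def)
  have "fejer_sum (2 ^ Suc m) t = (1 + rademacher m t) * fejer_sum (2 ^ m) t + 2 ^ m * cyl_kernel m t"
    using fejer_sum_add_exp[of "2 ^ m" m t] by (simp add: mult_2 algebra_simps)
  then have "\<bar>fejer_sum (2 ^ Suc m) t\<bar>
      \<le> \<bar>(1 + rademacher m t) * fejer_sum (2 ^ m) t\<bar> + \<bar>2 ^ m * cyl_kernel m t\<bar>"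
    by simp
  also have "\<dots> = (1 + rademacher m t) * \<bar>fejer_sum (2 ^ m) t\<bar> + 2 ^ m * cyl_kernel m t"
    using rad cyl_kernel_nonneg[of m t] by (simp add: abs_mult)
  also have "\<dots> \<le> (1 + rademacher m t) * (2 ^ m * flip_kernel m t) + 2 ^ m * cyl_kernel m t"
    using mult_left_mono[OF Suc rad] by simp
  also have "(1 + rademacher m t) * (2 ^ m * flip_kernel m t)
      = (\<Sum>j<m. 2 ^ j * ((1 + rademacher m t) * cyl_kernel m (bit_flip j t)))
        + 2 ^ m * ((1 + rademacher m t) * cyl_kernel m t)"
    unfolding U by (simp add: lessThan_Suc_atMost[symmetric] top sum_distrib_left algebra_simps)
  also have "\<dots> = (\<Sum>j<m. 2 ^ j * cyl_kernel (Suc m) (bit_flip j t)) + 2 ^ m * cyl_kernel (Suc m) t"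
    by (simp add: low cyl_kernel_Suc[symmetric])
  \<comment> \<open>After halving, the unflipped kernel of order m + 1 carries 3/2 of 2^m where 2 *
    2^m is available, and the one flipped at m carries 1/2 of 2^m where 2^m is available.\<close>
  also have "\<dots> + 2 ^ m * cyl_kernel m t \<le> 2 ^ Suc m * flip_kernel (Suc m) t"
  proof -
    have "2 ^ Suc m * flip_kernel (Suc m) t
      = (\<Sum>j<m. 2 ^ j * cyl_kernel (Suc m) (bit_flip j t))
        + 2 ^ m * cyl_kernel (Suc m) (bit_flip m t) + 2 * 2 ^ m * cyl_kernel (Suc m) t"
      unfolding U using top[of "Suc m"] by (simp add: lessThan_Suc_atMost[symmetric])
    moreover have "2 ^ m * (2 * cyl_kernel m t)
        = 2 ^ m * cyl_kernel (Suc m) t + 2 ^ m * cyl_kernel (Suc m) (bit_flip m t)"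
      by (simp only: cyl_kernel_split distrib_left)
    moreover have "0 \<le> (2::real) ^ m * cyl_kernel (Suc m) t"
      "0 \<le> (2::real) ^ m * cyl_kernel (Suc m) (bit_flip m t)"
      by (simp_all add: cyl_kernel_nonneg)
    ultimately show ?thesis by (simp only: mult.assoc)
  qed
  finally show ?case .
qed

text \<open>Split off the leading digit 2^m of j. The sum up to 2^m and the p < 2^m copies of
  \<open>cyl_kernel m\<close> each cost 2^m times \<open>flip_kernel m\<close>, hence the factor 2;
  the rest is the Fejer sum of p. The bound runs over all orders 2^i up to j, so that its index set
  depends only on the size of j.\<close>

lemma abs_fejer_sum_le:
  "\<bar>fejer_sum j t\<bar> \<le> (\<Sum>i | 2 ^ i \<le> j. 2 * 2 ^ i * flip_kernel i t)"
proof (induction j rule: less_induct)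
  case (less j)
  show ?case
  proof (cases "j = 0")
    case False
    define m where "m = floor_log j"
    define p where "p = j - 2 ^ m"
    have jm: "2 ^ m \<le> j" "j < 2 * 2 ^ m"
      using False floor_log_exp2_le[of j] floor_log_exp2_gt[of j] by (auto simp: m_def)
    have p: "j = 2 ^ m + p" "p < 2 ^ m" "p < j" using jm by (auto simp: p_def)
    have fin: "finite {i. (2::nat) ^ i \<le> k}" for k
      by (rule finite_subset[of _ "{..k}"]) (auto intro: order_trans[OF less_imp_le[OF less_exp]])
    have ins: "insert m {i. 2 ^ i \<le> p} \<subseteq> {i. 2 ^ i \<le> j}" "m \<notin> {i. 2 ^ i \<le> p}"
      using p by auto
    have "\<bar>fejer_sum j t\<bar> \<le> \<bar>fejer_sum (2 ^ m) t\<bar> + \<bar>real p * cyl_kernel m t\<bar>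
        + \<bar>rademacher m t * fejer_sum p t\<bar>"
      using fejer_sum_add_exp[of p m t] p by simp
    also have "\<dots> = \<bar>fejer_sum (2 ^ m) t\<bar> + real p * cyl_kernel m t + \<bar>fejer_sum p t\<bar>"
      by (simp add: abs_mult abs_rademacher cyl_kernel_nonneg)
    also have "\<dots> \<le> 2 ^ m * flip_kernel m t + 2 ^ m * flip_kernel m t
        + (\<Sum>i | 2 ^ i \<le> p. 2 * 2 ^ i * flip_kernel i t)"
    proof (intro add_mono abs_fejer_sum_exp_le less.IH p mult_mono cyl_kernel_le_flip_kernel)
      show "real p \<le> 2 ^ m" using p(2) of_nat_less_iff[of p "2 ^ m", where 'a = real] by simp
    qed (auto simp: cyl_kernel_nonneg)
    also have "\<dots> = (\<Sum>i \<in> insert m {i. 2 ^ i \<le> p}. 2 * 2 ^ i * flip_kernel i t)"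
      using ins(2) fin by simp
    also have "\<dots> \<le> (\<Sum>i | 2 ^ i \<le> j. 2 * 2 ^ i * flip_kernel i t)"
      using ins(1) fin by (intro sum_mono2) (auto simp: flip_kernel_nonneg)
    finally show ?thesis .
  qed (simp add: fejer_sum_def)
qed

section \<open>Summation by parts and the Norlund kernel\<close>

lemma sum_by_parts:
  fixes c d :: "nat \<Rightarrow> real"
  shows "(\<Sum>j=1..J. c j * d j)
    = (\<Sum>j=1..J. (c j - c (Suc j)) * (\<Sum>i=1..j. d i)) + c (Suc J) * (\<Sum>i=1..J. d i)"
  by (induction J) (simp_all add: algebra_simps)

text \<open>Summation by parts turns the Dirichlet kernels into Fejer sums with nonnegative
  coefficients. After exchanging sums, the coefficients belonging to a fixed i telescope over j from
  2^i on and leave c (2^i).\<close>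

lemma abs_sum_dirichlet_le:
  fixes c :: "nat \<Rightarrow> real"
  assumes nonneg: "\<And>j. 0 \<le> c j" and noninc: "\<And>j. c (Suc j) \<le> c j"
  shows "\<bar>\<Sum>j=1..<2 ^ m. c j * dirichlet j t\<bar> \<le> (\<Sum>i<m. 2 * 2 ^ i * c (2 ^ i) * flip_kernel i t)"
proof -
  define N :: nat where "N = 2 ^ m"
  have N: "1 \<le> N" by (simp add: N_def)
  \<comment> \<open>Truncation at N makes the boundary term of the summation by parts vanish; since
    c is nonnegative, the cut keeps the sequence nonincreasing.\<close>
  define b where "b j = (if j < N then c j else 0)" for j
  have b_noninc: "b (Suc j) \<le> b j" for j using nonneg noninc by (simp add: b_def)
  have pow: "(2::nat) ^ i < N \<longleftrightarrow> i < m" for i by (simp add: N_def)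
  have S: "{1..N - 1} = {1..<N}" using N by auto
  have "(\<Sum>j=1..<N. c j * dirichlet j t) = (\<Sum>j=1..N - 1. b j * dirichlet j t)"
    unfolding S by (intro sum.cong) (auto simp: b_def)
  also have "\<dots> = (\<Sum>j=1..N - 1. (b j - b (Suc j)) * fejer_sum j t)"
    using N by (subst sum_by_parts) (simp add: b_def fejer_sum_def)
  finally have "\<bar>\<Sum>j=1..<N. c j * dirichlet j t\<bar> \<le> (\<Sum>j=1..N - 1. \<bar>(b j - b (Suc j)) * fejer_sum j t\<bar>)"
    by simp
  also have "\<dots> \<le> (\<Sum>j=1..N - 1. (b j - b (Suc j)) * (\<Sum>i | 2 ^ i \<le> j. 2 * 2 ^ i * flip_kernel i t))"
    using b_noninc by (intro sum_mono) (auto simp: abs_mult intro!: mult_left_mono abs_fejer_sum_le)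
  \<comment> \<open>As 2^i <= j < 2^m forces i < m, the inner sum ranges over part of a fixed finite
    set, which prepares the exchange of sums.\<close>
  also have "\<dots> = (\<Sum>j=1..N - 1. \<Sum>i | i < m \<and> 2 ^ i \<le> j. (b j - b (Suc j)) * (2 * 2 ^ i * flip_kernel i t))"
    unfolding sum_distrib_left
  proof (intro sum.cong refl)
    fix j assume "j \<in> {1..N - 1}"
    then have "j < N" using N by auto
    then show "{i. 2 ^ i \<le> j} = {i. i < m \<and> 2 ^ i \<le> j}"
      using pow by (auto intro: le_less_trans)
  qed
  also have "\<dots> = (\<Sum>j\<in>{1..N - 1}. \<Sum>i\<in>{i\<in>{..<m}. 2 ^ i \<le> j}. (b j - b (Suc j)) * (2 * 2 ^ i * flip_kernel i t))"
    by simp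
  also have "\<dots> = (\<Sum>i<m. \<Sum>j | j \<in> {1..N - 1} \<and> 2 ^ i \<le> j. (b j - b (Suc j)) * (2 * 2 ^ i * flip_kernel i t))"
    by (rule sum.swap_restrict) auto
  also have "\<dots> = (\<Sum>i<m. 2 * 2 ^ i * c (2 ^ i) * flip_kernel i t)"
  proof (intro sum.cong refl)
    fix i assume "i \<in> {..<m}"
    then have lt: "2 ^ i < N" using pow by simp
    have "1 \<le> j" if "2 ^ i \<le> j" for j :: nat
      using that one_le_power[of "2::nat" i] by linarith
    then have "j \<in> {1..N - 1} \<and> 2 ^ i \<le> j \<longleftrightarrow> j \<in> {2 ^ i..<N}" for j
      unfolding S by (metis atLeastLessThan_iff)
    then have "{j. j \<in> {1..N - 1} \<and> 2 ^ i \<le> j} = {2 ^ i..<N}"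
      by blast
    then have "(\<Sum>j | j \<in> {1..N - 1} \<and> 2 ^ i \<le> j. b j - b (Suc j)) = (\<Sum>j=2 ^ i..<N. b j - b (Suc j))"
      by simp
    also have "\<dots> = b (2 ^ i) - b N"
      using lt sum_Suc_diff'[of "2 ^ i" N "\<lambda>j. - b j"] by simp
    also have "\<dots> = c (2 ^ i)" using lt by (simp add: b_def)
    finally show "(\<Sum>j | j \<in> {1..N - 1} \<and> 2 ^ i \<le> j. (b j - b (Suc j)) * (2 * 2 ^ i * flip_kernel i t))
        = 2 * 2 ^ i * c (2 ^ i) * flip_kernel i t"
      by (simp add: sum_distrib_right[symmetric])
  qed
  finally show ?thesis by (simp add: N_def)
qed

text \<open>Cauchy condensation: the block of indices above 2^m up to 2^(m+1) has 2^m terms, each at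
  least c (2^(m+1)), so twice the block pays for the new summand.\<close>

lemma sum_condensation_le:
  fixes c :: "nat \<Rightarrow> real"
  assumes nonneg: "\<And>j. 0 \<le> c j" and noninc: "\<And>i j. i \<le> j \<Longrightarrow> c j \<le> c i"
  shows "(\<Sum>i\<le>m. 2 ^ i * c (2 ^ i)) \<le> 2 * (\<Sum>j=1..2 ^ m. c j)"
proof (induction m)
  case 0
  then show ?case using nonneg[of 1] by simp
next
  case (Suc m)
  have "{1..2 ^ Suc m} = {1..2 ^ m} \<union> {(2::nat) ^ m<..2 ^ Suc m}" by auto
  then have "(\<Sum>j=1..2 ^ Suc m. c j) = (\<Sum>j=1..2 ^ m. c j) + (\<Sum>j\<in>{2 ^ m<..2 ^ Suc m}. c j)"
    by (simp only:) (rule sum.union_disjoint, auto)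
  moreover have "(\<Sum>j\<in>{(2::nat) ^ m<..2 ^ Suc m}. c (2 ^ Suc m)) \<le> (\<Sum>j\<in>{2 ^ m<..2 ^ Suc m}. c j)"
    by (intro sum_mono noninc) auto
  ultimately show ?case using Suc by simp
qed

text \<open>For k <= 2^m put k = 2^m - j and use \<open>dirichlet_diff_exp\<close>; for larger k put
  k = 2^m + j and use \<open>dirichlet_add_exp\<close>. Every k yields one copy of
  \<open>cyl_kernel m\<close>, and together their coefficients are q 0, ..., q (n - 1).\<close>

lemma norlund_kernel_split:
  fixes q :: "nat \<Rightarrow> real"
  assumes r: "r < 2 ^ m" and n: "n = 2 ^ m + r"
  shows "(\<Sum>k=1..n. q (n - k) * dirichlet k t)
    = norlund_weight q n * cyl_kernel m t
      - walsh (2 ^ m - 1) t * (\<Sum>j=1..<2 ^ m. q (r + j) * dirichlet j t)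
      + rademacher m t * (\<Sum>j=1..r. q (r - j) * dirichlet j t)"
proof -
  define N :: nat where "N = 2 ^ m"
  have N: "1 \<le> N" by (simp add: N_def)
  have "{1..n} = {1..N} \<union> {N + 1..N + r}" using n N by (auto simp: N_def)
  then have "(\<Sum>k=1..n. q (n - k) * dirichlet k t)
      = (\<Sum>k=1..N. q (n - k) * dirichlet k t) + (\<Sum>k=N + 1..N + r. q (n - k) * dirichlet k t)"
    by (simp only:) (rule sum.union_disjoint, auto)
  also have "(\<Sum>k=1..N. q (n - k) * dirichlet k t) = (\<Sum>j<N. q (r + j) * dirichlet (N - j) t)"
    by (rule sum.reindex_bij_witness[where i = "\<lambda>j. N - j" and j = "\<lambda>k. N - k"])
      (auto simp: n N_def[symmetric] add.commute)
  also have "\<dots> = (\<Sum>j<N. q (r + j) * cyl_kernel m t - walsh (N - 1) t * (q (r + j) * dirichlet j t))"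
    by (intro sum.cong refl)
      (simp add: N_def dirichlet_diff_exp dirichlet_exp algebra_simps)
  also have "\<dots> = (\<Sum>j<N. q (r + j)) * cyl_kernel m t
      - walsh (N - 1) t * (\<Sum>j<N. q (r + j) * dirichlet j t)"
    by (simp add: sum_subtractf sum_distrib_left sum_distrib_right)
  \<comment> \<open>The term j = 0 drops out because \<open>dirichlet 0\<close> vanishes.\<close>
  also have "(\<Sum>j<N. q (r + j) * dirichlet j t) = (\<Sum>j=1..<N. q (r + j) * dirichlet j t)"
    by (rule sum.mono_neutral_right) (auto simp: not_less_eq_eq)
  also have "(\<Sum>k=N + 1..N + r. q (n - k) * dirichlet k t) = (\<Sum>j=1..r. q (r - j) * dirichlet (N + j) t)"
    by (rule sum.reindex_bij_witness[where i = "\<lambda>j. N + j" and j = "\<lambda>k. k - N"])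
      (auto simp: n N_def[symmetric] add.commute)
  also have "\<dots> = (\<Sum>j=1..r. q (r - j) * cyl_kernel m t + rademacher m t * (q (r - j) * dirichlet j t))"
    unfolding N_def using r by (intro sum.cong refl, subst dirichlet_add_exp)
      (auto simp: dirichlet_exp algebra_simps)
  also have "\<dots> = (\<Sum>j=1..r. q (r - j)) * cyl_kernel m t
      + rademacher m t * (\<Sum>j=1..r. q (r - j) * dirichlet j t)"
    by (simp add: sum.distrib sum_distrib_left sum_distrib_right)
  also have "(\<Sum>j=1..r. q (r - j)) = (\<Sum>i<r. q i)"
    by (rule sum.reindex_bij_witness[where i = "\<lambda>j. r - j" and j = "\<lambda>k. r - k"]) auto
  moreover have "norlund_weight q n = (\<Sum>i<r. q i) + (\<Sum>j<N. q (r + j))"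
  proof -
    have "(\<Sum>i<n. q i) = (\<Sum>i<r. q i) + (\<Sum>i=r..<r + N. q i)"
      using sum.atLeastLessThan_concat[of 0 r n q] by (simp add: n N_def add.commute lessThan_atLeast0)
    also have "(\<Sum>i=r..<r + N. q i) = (\<Sum>j<N. q (r + j))"
      by (rule sum.reindex_bij_witness[where i = "\<lambda>j. r + j" and j = "\<lambda>k. k - r"]) auto
    finally show ?thesis by (simp add: norlund_weight_def)
  qed
  ultimately show ?thesis by (simp add: N_def algebra_simps)
qed

text \<open>In the middle sum of \<open>norlund_kernel_split\<close> the weights q (r + j) are
  nonincreasing in j, so \<open>abs_sum_dirichlet_le\<close> applies. In the last sum q (r - j) runs
  the other way; bounding it by q 0 and each of the r kernels by \<open>abs_dirichlet_le\<close>
  costs q 0 * r at every order i < m.\<close>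

lemma abs_norlund_kernel_le:
  fixes q :: "nat \<Rightarrow> real"
  assumes r: "r < 2 ^ m" and n: "n = 2 ^ m + r"
    and nonneg: "\<And>k. 0 \<le> q k" and noninc: "\<And>k. q (Suc k) \<le> q k"
  shows "\<bar>\<Sum>k=1..n. q (n - k) * dirichlet k t\<bar>
    \<le> norlund_weight q n * flip_kernel m t
      + (\<Sum>i<m. (2 * 2 ^ i * q (r + 2 ^ i) + q 0 * real r) * flip_kernel i t)"
proof -
  have Q: "0 \<le> norlund_weight q n" using nonneg by (simp add: norlund_weight_def sum_nonneg)
  have q_le: "q k \<le> q 0" for k
    by (rule lift_Suc_antimono_le[of q]) (use noninc in auto)
  have mid: "\<bar>\<Sum>j=1..<2 ^ m. q (r + j) * dirichlet j t\<bar>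
      \<le> (\<Sum>i<m. 2 * 2 ^ i * q (r + 2 ^ i) * flip_kernel i t)"
    using nonneg noninc abs_sum_dirichlet_le[where c = "\<lambda>j. q (r + j)" and m = m and t = t] by simp
  have "\<bar>\<Sum>j=1..r. q (r - j) * dirichlet j t\<bar> \<le> (\<Sum>j=1..r. \<bar>q (r - j) * dirichlet j t\<bar>)"
    by (rule sum_abs)
  also have "\<dots> \<le> (\<Sum>j=1..r. q 0 * (\<Sum>i<m. flip_kernel i t))"
  proof (intro sum_mono)
    fix j assume "j \<in> {1..r}"
    then have "\<bar>dirichlet j t\<bar> \<le> (\<Sum>i<m. cyl_kernel i t)" using r by (intro abs_dirichlet_le) auto
    also have "\<dots> \<le> (\<Sum>i<m. flip_kernel i t)" by (intro sum_mono cyl_kernel_le_flip_kernel)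
    finally show "\<bar>q (r - j) * dirichlet j t\<bar> \<le> q 0 * (\<Sum>i<m. flip_kernel i t)"
      using nonneg q_le by (simp add: abs_mult mult_mono)
  qed
  finally have tail: "\<bar>\<Sum>j=1..r. q (r - j) * dirichlet j t\<bar> \<le> (\<Sum>i<m. q 0 * real r * flip_kernel i t)"
    by (simp add: sum_distrib_left mult_ac)
  have "\<bar>\<Sum>k=1..n. q (n - k) * dirichlet k t\<bar>
      \<le> \<bar>norlund_weight q n * cyl_kernel m t\<bar>
        + \<bar>walsh (2 ^ m - 1) t * (\<Sum>j=1..<2 ^ m. q (r + j) * dirichlet j t)\<bar>
        + \<bar>rademacher m t * (\<Sum>j=1..r. q (r - j) * dirichlet j t)\<bar>"
    unfolding norlund_kernel_split[OF r n] by linarith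
  also have "\<dots> = norlund_weight q n * cyl_kernel m t
        + \<bar>\<Sum>j=1..<2 ^ m. q (r + j) * dirichlet j t\<bar>
        + \<bar>\<Sum>j=1..r. q (r - j) * dirichlet j t\<bar>"
    using Q by (simp add: abs_mult abs_walsh abs_rademacher cyl_kernel_nonneg)
  also have "\<dots> \<le> norlund_weight q n * flip_kernel m t
        + (\<Sum>i<m. 2 * 2 ^ i * q (r + 2 ^ i) * flip_kernel i t)
        + (\<Sum>i<m. q 0 * real r * flip_kernel i t)"
    by (intro add_mono mid tail mult_left_mono cyl_kernel_le_flip_kernel Q)
  finally show ?thesis by (simp add: sum.distrib[symmetric] distrib_right add.assoc)
qed

section \<open>The weak type inequality\<close>

lemma measurable_coordinate [measurable]: "(\<lambda>x. x k) \<in> dyadic_haar \<rightarrow>\<^sub>M count_space UNIV"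
proof -
  have "(\<lambda>x. x k) \<in> dyadic_haar \<rightarrow>\<^sub>M uniform_count_measure (UNIV :: bit set)"
    unfolding dyadic_haar_def by (rule measurable_component_singleton) simp
  then show ?thesis
    by (subst (asm) measurable_cong_sets[OF refl sets_uniform_count_measure_count_space])
qed

lemma measurable_dyadicI:
  assumes "\<And>k. (\<lambda>p. g p k) \<in> M \<rightarrow>\<^sub>M count_space (UNIV :: bit set)"
  shows "g \<in> M \<rightarrow>\<^sub>M dyadic_haar"
  unfolding dyadic_haar_def
proof (rule measurable_PiM_single')
  fix k
  show "(\<lambda>p. g p k) \<in> M \<rightarrow>\<^sub>M uniform_count_measure UNIV"
    using assms[of k]
    by (subst measurable_cong_sets[OF refl sets_uniform_count_measure_count_space])
qed (auto simp: space_uniform_count_measure)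

lemma measurable_bit_add [measurable (raw)]:
  assumes [measurable]: "g \<in> M \<rightarrow>\<^sub>M dyadic_haar" "h \<in> M \<rightarrow>\<^sub>M dyadic_haar"
  shows "(\<lambda>p. bit_add (g p) (h p)) \<in> M \<rightarrow>\<^sub>M dyadic_haar"
proof (rule measurable_dyadicI)
  fix k
  have [measurable]: "(\<lambda>p. g p k) \<in> M \<rightarrow>\<^sub>M count_space UNIV" "(\<lambda>p. h p k) \<in> M \<rightarrow>\<^sub>M count_space UNIV"
    by (rule measurable_compose[OF _ measurable_coordinate]; fact)+
  \<comment> \<open>Addition of bits as a case distinction, a form whose measurability follows from
    that of the two coordinates.\<close>
  have "(\<lambda>p. if g p k = 0 then h p k else if h p k = 0 then 1 else 0) \<in> M \<rightarrow>\<^sub>M count_space UNIV"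
    by measurable
  also have "(\<lambda>p. if g p k = 0 then h p k else if h p k = 0 then 1 else 0) = (\<lambda>p. bit_add (g p) (h p) k)"
    by (auto simp: bit_add_def fun_eq_iff bit_neq_0_iff)
  finally show "(\<lambda>p. bit_add (g p) (h p) k) \<in> M \<rightarrow>\<^sub>M count_space UNIV" .
qed

lemma bit_flip_eq_bit_add: "bit_flip j x = bit_add x (\<lambda>k. if k = j then 1 else 0)"
  by (auto simp: bit_flip_def bit_add_def fun_eq_iff)

lemma measurable_bit_flip [measurable]: "bit_flip j \<in> dyadic_haar \<rightarrow>\<^sub>M dyadic_haar"
  unfolding bit_flip_eq_bit_add[abs_def] by measurable

lemma measurable_rademacher [measurable]: "rademacher k \<in> borel_measurable dyadic_haar"
  unfolding rademacher_def[abs_def] by measurable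

lemma measurable_walsh [measurable]: "walsh n \<in> borel_measurable dyadic_haar"
  unfolding walsh_def[abs_def] by measurable

lemma measurable_dirichlet [measurable]: "dirichlet n \<in> borel_measurable dyadic_haar"
  unfolding dirichlet_def[abs_def] by measurable

lemma measurable_cyl_kernel [measurable]: "cyl_kernel m \<in> borel_measurable dyadic_haar"
  unfolding dirichlet_exp[symmetric, abs_def] by measurable

lemma measurable_flip_kernel [measurable]: "flip_kernel m \<in> borel_measurable dyadic_haar"
  unfolding flip_kernel_def[abs_def] by measurable

interpretation haar: prob_space dyadic_haar
  by (rule prob_space_dyadic_haar)

interpretation haar2: pair_sigma_finite dyadic_haar dyadic_haar ..

lemma distr_bit_flip: "distr dyadic_haar dyadic_haar (bit_flip j) = dyadic_haar"
  using dyadic_haar_translation_invariant[of "\<lambda>k. if k = j then 1 else 0"]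
  by (simp add: bit_flip_eq_bit_add[abs_def] bit_add_def)

lemma nn_integral_bit_flip:
  assumes [measurable]: "g \<in> borel_measurable dyadic_haar"
  shows "(\<integral>\<^sup>+ x. g (bit_flip j x) \<partial>dyadic_haar) = (\<integral>\<^sup>+ x. g x \<partial>dyadic_haar)"
  using nn_integral_distr[of "bit_flip j" dyadic_haar dyadic_haar g] by (simp add: distr_bit_flip)

text \<open>If digit k of n is 1, flipping coordinate k changes the sign of \<open>walsh n\<close>
  but not its integral, which is therefore 0.\<close>

lemma integral_walsh: "(\<integral>x. walsh n x \<partial>dyadic_haar) = (if n = 0 then 1 else 0)"
proof (cases "n = 0")
  case False
  then obtain k where k: "bit n k" by (metis bit_eq_iff bit_0_eq bot_apply bot_bool_def)
  have "walsh n (bit_flip k x) = - walsh n x" for x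
  proof -
    have "rademacher i (bit_flip k x) = (if i = k then - 1 else 1) * rademacher i x" for i
      by (cases "x k") (auto simp: rademacher_def bit_flip_def)
    then have "walsh n (bit_flip k x) = (\<Prod>i | bit n i. if i = k then - 1 else 1) * walsh n x"
      by (simp add: walsh_def prod.distrib)
    then show ?thesis using k finite_bits_nat[of n] by (simp add: prod.delta)
  qed
  moreover have "(\<integral>x. walsh n (bit_flip k x) \<partial>dyadic_haar) = (\<integral>x. walsh n x \<partial>dyadic_haar)"
    using integral_distr[of "bit_flip k" dyadic_haar dyadic_haar "walsh n"] by (simp add: distr_bit_flip)
  ultimately show ?thesis using False by simp
qed (use haar.prob_space in simp)

lemma integrable_walsh: "integrable dyadic_haar (\<lambda>y. walsh n y)"
  by (rule haar.integrable_const_bound[where B = 1]) (auto simp: abs_walsh)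

lemma dirichlet_bit_add: "dirichlet n (bit_add x y) = (\<Sum>i<n. walsh i x * walsh i y)"
  by (simp add: dirichlet_def walsh_bit_add)

text \<open>Only the summand i = 0 has nonzero mean, and it is present because n > 0.\<close>

lemma integral_dirichlet:
  assumes "0 < n"
  shows "(\<integral>y. dirichlet n (bit_add x y) \<partial>dyadic_haar) = 1"
proof -
  have "(\<integral>y. dirichlet n (bit_add x y) \<partial>dyadic_haar)
      = (\<Sum>i<n. walsh i x * (if i = 0 then 1 else 0))"
    by (simp add: dirichlet_bit_add integrable_walsh integral_walsh)
  also have "\<dots> = 1" using assms by (simp add: if_distrib[of "\<lambda>c. _ * c"] sum.delta cong: if_cong)
  finally show ?thesis .
qed

lemma nn_integral_cyl_kernel:
  "(\<integral>\<^sup>+ y. ennreal (cyl_kernel m (bit_add x y)) \<partial>dyadic_haar) = 1"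
proof -
  have "integrable dyadic_haar (\<lambda>y. cyl_kernel m (bit_add x y))"
    unfolding dirichlet_exp[symmetric] dirichlet_bit_add by (simp add: integrable_walsh)
  then show ?thesis
    using integral_dirichlet[of "2 ^ m" x]
    by (subst nn_integral_eq_integral) (auto simp: cyl_kernel_nonneg dirichlet_exp)
qed

section \<open>Conditional expectations and their flipped combinations\<close>

lemma bit_add_flip: "bit_add (bit_flip j x) y = bit_flip j (bit_add x y)"
  unfolding bit_flip_eq_bit_add unfolding bit_add_def by (simp only: ac_simps)

lemma cyl_kernel_bit_add: "cyl_kernel m (bit_add x y) = (if \<forall>i<m. x i = y i then 2 ^ m else 0)"
  unfolding cyl_kernel_def bit_add_def bit_add_eq_0_iff ..

text \<open>The conditional expectation of g given the first m digits. Values in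
  \<open>ennreal\<close> make it exist for every nonnegative measurable g.\<close>

definition dyadic_avg :: "nat \<Rightarrow> (dyadic \<Rightarrow> ennreal) \<Rightarrow> dyadic \<Rightarrow> ennreal" where
  "dyadic_avg m g x = (\<integral>\<^sup>+ y. g y * ennreal (cyl_kernel m (bit_add x y)) \<partial>dyadic_haar)"

text \<open>Convolution with \<open>flip_kernel m\<close>, as \<open>flip_avg_kernel\<close> shows;
  this form exposes the conditional expectations to which stopping arguments apply.\<close>

definition flip_avg :: "nat \<Rightarrow> (dyadic \<Rightarrow> ennreal) \<Rightarrow> dyadic \<Rightarrow> ennreal" where
  "flip_avg m g x = (\<Sum>j\<le>m. ennreal (2 ^ j / 2 ^ m) * dyadic_avg m g (bit_flip j x))"

lemma measurable_dyadic_avg [measurable]: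
  assumes [measurable]: "g \<in> borel_measurable dyadic_haar"
  shows "dyadic_avg m g \<in> borel_measurable dyadic_haar"
  unfolding dyadic_avg_def[abs_def] by measurable

lemma measurable_flip_avg [measurable]:
  assumes [measurable]: "g \<in> borel_measurable dyadic_haar"
  shows "flip_avg m g \<in> borel_measurable dyadic_haar"
  unfolding flip_avg_def[abs_def] by measurable

lemma dyadic_avg_cong:
  assumes "\<And>i. i < m \<Longrightarrow> x i = x' i"
  shows "dyadic_avg m g x = dyadic_avg m g x'"
  using assms by (auto simp: dyadic_avg_def cyl_kernel_bit_add cong: nn_integral_cong)

text \<open>The defining property of conditional expectation. Where the kernel does not vanish, x
  and y share their first m digits, so \<open>\<phi> x\<close> may be replaced by
  \<open>\<phi> y\<close>; then Tonelli's theorem and the total mass 1 of the kernel finish.\<close>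

lemma nn_integral_dyadic_avg:
  assumes [measurable]: "g \<in> borel_measurable dyadic_haar" "\<phi> \<in> borel_measurable dyadic_haar"
    and \<phi>: "\<And>x x'. (\<And>i. i < m \<Longrightarrow> x i = x' i) \<Longrightarrow> \<phi> x = \<phi> x'"
  shows "(\<integral>\<^sup>+ x. dyadic_avg m g x * \<phi> x \<partial>dyadic_haar) = (\<integral>\<^sup>+ x. g x * \<phi> x \<partial>dyadic_haar)"
proof -
  have eq: "g y * ennreal (cyl_kernel m (bit_add x y)) * \<phi> x
      = g y * \<phi> y * ennreal (cyl_kernel m (bit_add y x))" for x y
    using \<phi>[of x y] by (auto simp: cyl_kernel_bit_add mult_ac)
  have "(\<integral>\<^sup>+ x. dyadic_avg m g x * \<phi> x \<partial>dyadic_haar)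
      = (\<integral>\<^sup>+ x. \<integral>\<^sup>+ y. g y * ennreal (cyl_kernel m (bit_add x y)) * \<phi> x \<partial>dyadic_haar \<partial>dyadic_haar)"
    by (simp add: dyadic_avg_def nn_integral_multc)
  also have "\<dots> = (\<integral>\<^sup>+ y. \<integral>\<^sup>+ x. g y * ennreal (cyl_kernel m (bit_add x y)) * \<phi> x \<partial>dyadic_haar \<partial>dyadic_haar)"
    by (rule haar2.Fubini') measurable
  also have "\<dots> = (\<integral>\<^sup>+ y. g y * \<phi> y \<partial>dyadic_haar)"
    by (simp add: eq nn_integral_cmult nn_integral_cyl_kernel)
  finally show ?thesis .
qed

lemma flip_avg_kernel:
  assumes [measurable]: "g \<in> borel_measurable dyadic_haar"
  shows "flip_avg m g x = (\<integral>\<^sup>+ y. g y * ennreal (flip_kernel m (bit_add x y)) \<partial>dyadic_haar)"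
proof -
  have "flip_avg m g x
      = (\<Sum>j\<le>m. \<integral>\<^sup>+ y. ennreal (2 ^ j / 2 ^ m) * (g y * ennreal (cyl_kernel m (bit_flip j (bit_add x y)))) \<partial>dyadic_haar)"
    by (simp add: flip_avg_def dyadic_avg_def bit_add_flip nn_integral_cmult)
  also have "\<dots> = (\<integral>\<^sup>+ y. (\<Sum>j\<le>m. ennreal (2 ^ j / 2 ^ m) * (g y * ennreal (cyl_kernel m (bit_flip j (bit_add x y))))) \<partial>dyadic_haar)"
    by (rule nn_integral_sum[symmetric]) measurable
  also have "\<dots> = (\<integral>\<^sup>+ y. g y * ennreal (flip_kernel m (bit_add x y)) \<partial>dyadic_haar)"
  proof (intro nn_integral_cong)
    fix y
    have "ennreal (flip_kernel m (bit_add x y))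
        = (\<Sum>j\<le>m. ennreal (2 ^ j / 2 ^ m * cyl_kernel m (bit_flip j (bit_add x y))))"
      unfolding flip_kernel_def by (intro sum_ennreal[symmetric]) (simp add: cyl_kernel_nonneg)
    also have "\<dots> = (\<Sum>j\<le>m. ennreal (2 ^ j / 2 ^ m) * ennreal (cyl_kernel m (bit_flip j (bit_add x y))))"
      by (intro sum.cong refl ennreal_mult) (simp_all add: cyl_kernel_nonneg)
    finally show "(\<Sum>j\<le>m. ennreal (2 ^ j / 2 ^ m) * (g y * ennreal (cyl_kernel m (bit_flip j (bit_add x y)))))
        = g y * ennreal (flip_kernel m (bit_add x y))"
      by (simp only: sum_distrib_left mult.left_commute)
  qed
  finally show ?thesis .
qed

lemma dyadic_avg_add:
  assumes [measurable]: "g \<in> borel_measurable dyadic_haar" "h \<in> borel_measurable dyadic_haar"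
  shows "dyadic_avg m (\<lambda>y. g y + h y) x = dyadic_avg m g x + dyadic_avg m h x"
  by (simp add: dyadic_avg_def distrib_right nn_integral_add)

lemma flip_avg_add:
  assumes [measurable]: "g \<in> borel_measurable dyadic_haar" "h \<in> borel_measurable dyadic_haar"
  shows "flip_avg m (\<lambda>y. g y + h y) x = flip_avg m g x + flip_avg m h x"
  by (simp add: flip_avg_def dyadic_avg_add distrib_left sum.distrib)

lemma dyadic_avg_mono: "(\<And>y. g y \<le> h y) \<Longrightarrow> dyadic_avg m g x \<le> dyadic_avg m h x"
  unfolding dyadic_avg_def by (intro nn_integral_mono mult_right_mono) auto

lemma flip_avg_mono: "(\<And>y. g y \<le> h y) \<Longrightarrow> flip_avg m g x \<le> flip_avg m h x"
  unfolding flip_avg_def by (intro sum_mono mult_left_mono dyadic_avg_mono) auto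

lemma dyadic_avg_const: "dyadic_avg m (\<lambda>y. c) x = c"
  by (simp add: dyadic_avg_def nn_integral_cmult nn_integral_cyl_kernel)

lemma sum_power2_quotient_le:
  "(\<Sum>j<l. ennreal (2 ^ j / 2 ^ m)) \<le> ennreal (2 ^ l / 2 ^ m)"
proof -
  have "(\<Sum>j<l. (2::real) ^ j / 2 ^ m) = (2 ^ l - 1) / 2 ^ m"
    using power_diff_1_eq[of "2::real" l] by (simp add: sum_divide_distrib[symmetric])
  then show ?thesis by (simp add: divide_right_mono ennreal_leI)
qed

lemma sum_flip_weights_le: "(\<Sum>j\<le>m. ennreal (2 ^ j / 2 ^ m)) \<le> 2"
  using sum_power2_quotient_le[of m "Suc m"] by (simp add: lessThan_Suc_atMost)

lemma flip_avg_const_le: "flip_avg m (\<lambda>y. c) x \<le> 2 * c"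
  unfolding flip_avg_def dyadic_avg_const sum_distrib_right[symmetric]
  by (intro mult_right_mono sum_flip_weights_le) simp

section \<open>Stopping sets and maximal inequalities\<close>

definition first_exceed :: "(dyadic \<Rightarrow> ennreal) \<Rightarrow> ennreal \<Rightarrow> nat \<Rightarrow> dyadic set" where
  "first_exceed g \<alpha> l = {x. \<alpha> < dyadic_avg l g x \<and> (\<forall>i<l. dyadic_avg i g x \<le> \<alpha>)}"

lemma sets_first_exceed [measurable]:
  assumes [measurable]: "g \<in> borel_measurable dyadic_haar"
  shows "first_exceed g \<alpha> l \<in> sets dyadic_haar"
proof -
  have "{x \<in> space dyadic_haar. \<alpha> < dyadic_avg l g x \<and> (\<forall>i<l. dyadic_avg i g x \<le> \<alpha>)} \<in> sets dyadic_haar"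
    by measurable
  then show ?thesis by (simp add: first_exceed_def)
qed

text \<open>The stopping time property: only averages of order at most l enter, and these read at
  most l digits.\<close>

lemma first_exceed_cong:
  assumes "\<And>i. i < l \<Longrightarrow> x i = x' i"
  shows "x \<in> first_exceed g \<alpha> l \<longleftrightarrow> x' \<in> first_exceed g \<alpha> l"
proof -
  have "dyadic_avg i g x = dyadic_avg i g x'" if "i \<le> l" for i
    using assms that by (intro dyadic_avg_cong) auto
  then show ?thesis by (auto simp: first_exceed_def)
qed

lemma dyadic_avg_le_if_not_first_exceed:
  assumes "\<And>i. i \<le> l \<Longrightarrow> x \<notin> first_exceed g \<alpha> i"
  shows "dyadic_avg l g x \<le> \<alpha>"
  using assms
proof (induction l rule: less_induct)
  case (less l)
  have "dyadic_avg i g x \<le> \<alpha>" if "i < l" for i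
    using that less.prems by (intro less.IH) auto
  moreover have "x \<notin> first_exceed g \<alpha> l" using less.prems by simp
  ultimately have "\<not> \<alpha> < dyadic_avg l g x" unfolding first_exceed_def by blast
  then show ?case by simp
qed

text \<open>The indicator of the stopping set depends on the first l <= m digits only, so it can
  serve as the test function in \<open>nn_integral_dyadic_avg\<close>.\<close>

lemma nn_integral_avg_first_exceed:
  assumes [measurable]: "g \<in> borel_measurable dyadic_haar" and "l \<le> m"
  shows "(\<integral>\<^sup>+ x. dyadic_avg m g x * indicator (first_exceed g \<alpha> l) x \<partial>dyadic_haar)
    = (\<integral>\<^sup>+ x. g x * indicator (first_exceed g \<alpha> l) x \<partial>dyadic_haar)"
proof (rule nn_integral_dyadic_avg)
  fix x x' :: dyadic assume "\<And>i. i < m \<Longrightarrow> x i = x' i"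
  then have "x \<in> first_exceed g \<alpha> l \<longleftrightarrow> x' \<in> first_exceed g \<alpha> l"
    using \<open>l \<le> m\<close> by (intro first_exceed_cong) simp
  then show "indicator (first_exceed g \<alpha> l) x = (indicator (first_exceed g \<alpha> l) x' :: ennreal)"
    by (simp add: indicator_def)
qed measurable

lemma disjoint_first_exceed: "disjoint_family (first_exceed g \<alpha>)"
  unfolding disjoint_family_on_def
proof (intro ballI impI)
  fix k l :: nat assume "k \<noteq> l"
  then have "k < l \<or> l < k" by arith
  then show "first_exceed g \<alpha> k \<inter> first_exceed g \<alpha> l = {}"
    by (auto simp: first_exceed_def not_less[symmetric])
qed

lemma suminf_first_exceed_le:
  assumes [measurable]: "g \<in> borel_measurable dyadic_haar"
  shows "(\<Sum>l. \<integral>\<^sup>+ x. g x * indicator (first_exceed g \<alpha> l) x \<partial>dyadic_haar) \<le> (\<integral>\<^sup>+ x. g x \<partial>dyadic_haar)"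
proof -
  have "(\<Sum>l. \<integral>\<^sup>+ x. g x * indicator (first_exceed g \<alpha> l) x \<partial>dyadic_haar)
      = (\<integral>\<^sup>+ x. (\<Sum>l. g x * indicator (first_exceed g \<alpha> l) x) \<partial>dyadic_haar)"
    by (rule nn_integral_suminf[symmetric]) measurable
  also have "\<dots> = (\<integral>\<^sup>+ x. g x * indicator (\<Union>l. first_exceed g \<alpha> l) x \<partial>dyadic_haar)"
    by (simp add: suminf_indicator[OF disjoint_first_exceed])
  also have "\<dots> \<le> (\<integral>\<^sup>+ x. g x \<partial>dyadic_haar)"
    by (intro nn_integral_mono) (auto simp: indicator_def)
  finally show ?thesis .
qed

text \<open>Doob's maximal inequality: on the l-th stopping set the average of order l exceeds
  \<open>\<alpha>\<close> and has the same integral as g, and the stopping sets are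
  disjoint.\<close>

lemma first_exceed_weak_type:
  assumes [measurable]: "g \<in> borel_measurable dyadic_haar"
  shows "\<alpha> * emeasure dyadic_haar (\<Union>l. first_exceed g \<alpha> l) \<le> (\<integral>\<^sup>+ x. g x \<partial>dyadic_haar)"
proof -
  have "emeasure dyadic_haar (\<Union>l. first_exceed g \<alpha> l) = (\<Sum>l. emeasure dyadic_haar (first_exceed g \<alpha> l))"
    by (rule suminf_emeasure[symmetric]) (auto simp: disjoint_first_exceed)
  then have "\<alpha> * emeasure dyadic_haar (\<Union>l. first_exceed g \<alpha> l)
      = (\<Sum>l. \<integral>\<^sup>+ x. \<alpha> * indicator (first_exceed g \<alpha> l) x \<partial>dyadic_haar)"
    by (simp add: nn_integral_cmult_indicator)
  also have "\<dots> \<le> (\<Sum>l. \<integral>\<^sup>+ x. dyadic_avg l g x * indicator (first_exceed g \<alpha> l) x \<partial>dyadic_haar)"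
    by (intro suminf_le nn_integral_mono) (auto simp: indicator_def first_exceed_def)
  also have "\<dots> \<le> (\<integral>\<^sup>+ x. g x \<partial>dyadic_haar)"
    by (simp add: nn_integral_avg_first_exceed suminf_first_exceed_le)
  finally show ?thesis .
qed

text \<open>Off the set where the dyadic maximal function exceeds \<open>\<alpha>\<close>, an average of \<open>g\<close> around
  \<open>bit_flip j x\<close> can be large only if the stopping time \<open>l\<close> of that point is larger than \<open>j\<close>,
  since flipping digit \<open>j\<close> leaves the averages of order at most \<open>j\<close> unchanged. The sum of all
  these exceptional terms is integrable because the weights are summable over \<open>j < l\<close> and over
  the orders \<open>l + k\<close>.\<close>

definition flip_remainder :: "(dyadic \<Rightarrow> ennreal) \<Rightarrow> ennreal \<Rightarrow> dyadic \<Rightarrow> ennreal" where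
  "flip_remainder g \<alpha> x = (\<Sum>l. \<Sum>k. \<Sum>j<l. ennreal (2 ^ j / 2 ^ (l + k)) *
     (dyadic_avg (l + k) g (bit_flip j x) * indicator (first_exceed g \<alpha> l) (bit_flip j x)))"

lemma measurable_flip_remainder [measurable]:
  assumes [measurable]: "g \<in> borel_measurable dyadic_haar"
  shows "flip_remainder g \<alpha> \<in> borel_measurable dyadic_haar"
  unfolding flip_remainder_def[abs_def] by measurable

lemma nn_integral_flip_remainder_le:
  assumes [measurable]: "g \<in> borel_measurable dyadic_haar"
  shows "(\<integral>\<^sup>+ x. flip_remainder g \<alpha> x \<partial>dyadic_haar) \<le> 2 * (\<integral>\<^sup>+ x. g x \<partial>dyadic_haar)"
proof -
  let ?I = "\<lambda>l. \<integral>\<^sup>+ x. g x * indicator (first_exceed g \<alpha> l) x \<partial>dyadic_haar"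
  \<comment> \<open>Flip invariance removes \<open>bit_flip j\<close>, and since l <= l + k the
    average integrates over the stopping set like g. The value is independent of j and k, so only
    the weights remain to be summed: over j < l they give at most 2^(-k), and over k then 2.\<close>
  have int: "(\<integral>\<^sup>+ x. dyadic_avg (l + k) g (bit_flip j x) * indicator (first_exceed g \<alpha> l) (bit_flip j x) \<partial>dyadic_haar)
      = ?I l" for l k j
    using nn_integral_bit_flip[of "\<lambda>x. dyadic_avg (l + k) g x * indicator (first_exceed g \<alpha> l) x" j]
    by (simp add: nn_integral_avg_first_exceed)
  have "(\<integral>\<^sup>+ x. flip_remainder g \<alpha> x \<partial>dyadic_haar)
      = (\<Sum>l. \<Sum>k. \<Sum>j<l. ennreal (2 ^ j / 2 ^ (l + k)) * ?I l)"
    unfolding flip_remainder_def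
    by (simp add: nn_integral_suminf nn_integral_sum nn_integral_cmult int)
  also have "\<dots> \<le> (\<Sum>l. \<Sum>k. ennreal ((1 / 2) ^ k) * ?I l)"
  proof (intro suminf_le summableI)
    fix l k
    have "(\<Sum>j<l. ennreal (2 ^ j / 2 ^ (l + k))) \<le> ennreal ((1 / 2) ^ k)"
      using sum_power2_quotient_le[of "l + k" l] by (simp add: power_add power_one_over field_simps)
    then show "(\<Sum>j<l. ennreal (2 ^ j / 2 ^ (l + k)) * ?I l) \<le> ennreal ((1 / 2) ^ k) * ?I l"
      unfolding sum_distrib_right[symmetric] by (intro mult_right_mono) auto
  qed
  also have "\<dots> = (\<Sum>l. 2 * ?I l)"
  proof -
    have "(\<lambda>k. (1 / 2 :: real) ^ k) sums 2"
      using geometric_sums[of "1 / 2 :: real"] by simp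
    then have "(\<Sum>k. ennreal ((1 / 2) ^ k)) = ennreal 2"
      by (intro suminf_ennreal_eq) auto
    then have "(\<Sum>k. ennreal ((1 / 2) ^ k)) = 2" by simp
    then show ?thesis by (simp only: ennreal_suminf_multc)
  qed
  also have "\<dots> \<le> 2 * (\<integral>\<^sup>+ x. g x \<partial>dyadic_haar)"
    by (simp add: ennreal_suminf_cmult mult_left_mono suminf_first_exceed_le)
  finally show ?thesis .
qed

lemma flip_avg_le_flip_remainder:
  assumes x: "x \<notin> (\<Union>l. first_exceed g \<alpha> l)"
  shows "flip_avg m g x \<le> 2 * \<alpha> + flip_remainder g \<alpha> x"
proof -
  let ?T = "\<lambda>l k j. ennreal (2 ^ j / 2 ^ (l + k)) *
     (dyadic_avg (l + k) g (bit_flip j x) * indicator (first_exceed g \<alpha> l) (bit_flip j x))"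
  have avg: "dyadic_avg m g (bit_flip j x)
      \<le> \<alpha> + (\<Sum>l | l \<in> {..m} \<and> j < l. dyadic_avg m g (bit_flip j x) * indicator (first_exceed g \<alpha> l) (bit_flip j x))"
    (is "_ \<le> _ + ?S") for j
  proof (cases "\<exists>l\<le>m. bit_flip j x \<in> first_exceed g \<alpha> l")
    case True
    then obtain l where l: "l \<le> m" "bit_flip j x \<in> first_exceed g \<alpha> l" by blast
    \<comment> \<open>A flip at j >= l preserves the first l digits, so x itself would lie in the
      stopping set.\<close>
    have "j < l"
    proof (rule ccontr)
      assume "\<not> j < l"
      then have "x \<in> first_exceed g \<alpha> l"
        using l(2) by (subst first_exceed_cong[of l x "bit_flip j x"]) (auto simp: bit_flip_def)
      then show False using x by blast
    qed
    then have "dyadic_avg m g (bit_flip j x) * indicator (first_exceed g \<alpha> l) (bit_flip j x) \<le> ?S"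
      using l by (intro member_le_sum) auto
    then show ?thesis using l by (auto intro: order_trans add_increasing)
  next
    case False
    then have "dyadic_avg m g (bit_flip j x) \<le> \<alpha>"
      by (intro dyadic_avg_le_if_not_first_exceed) auto
    then show ?thesis by (auto intro: order_trans add_increasing2)
  qed
  have "flip_avg m g x \<le> (\<Sum>j\<le>m. ennreal (2 ^ j / 2 ^ m) * (\<alpha> + (\<Sum>l | l \<in> {..m} \<and> j < l.
      dyadic_avg m g (bit_flip j x) * indicator (first_exceed g \<alpha> l) (bit_flip j x))))"
    unfolding flip_avg_def by (intro sum_mono mult_left_mono avg) auto
  also have "\<dots> = (\<Sum>j\<le>m. ennreal (2 ^ j / 2 ^ m)) * \<alpha> + (\<Sum>j\<le>m. \<Sum>l | l \<in> {..m} \<and> j < l. ?T l (m - l) j)"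
  proof -
    have "(\<Sum>l | l \<in> {..m} \<and> j < l. ?T l (m - l) j) = ennreal (2 ^ j / 2 ^ m) *
      (\<Sum>l | l \<in> {..m} \<and> j < l. dyadic_avg m g (bit_flip j x) * indicator (first_exceed g \<alpha> l) (bit_flip j x))" for j
      unfolding sum_distrib_left by (intro sum.cong refl) simp
    then show ?thesis
      by (simp only: distrib_left sum.distrib sum_distrib_right)
  qed
  also have "(\<Sum>j\<le>m. \<Sum>l | l \<in> {..m} \<and> j < l. ?T l (m - l) j) = (\<Sum>l\<le>m. \<Sum>j | j \<in> {..m} \<and> j < l. ?T l (m - l) j)"
    by (rule sum.swap_restrict) auto
  also have "\<dots> = (\<Sum>l\<le>m. \<Sum>j<l. ?T l (m - l) j)"
    by (intro sum.cong) auto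
  \<comment> \<open>The order m is l + (m - l), so each left-hand summand is the single term k = m -
    l of a series with nonnegative terms.\<close>
  also have "\<dots> \<le> (\<Sum>l\<le>m. \<Sum>k. \<Sum>j<l. ?T l k j)"
  proof (intro sum_mono)
    fix l
    show "(\<Sum>j<l. ?T l (m - l) j) \<le> (\<Sum>k. \<Sum>j<l. ?T l k j)"
      using sum_le_suminf[of "\<lambda>k. \<Sum>j<l. ?T l k j" "{m - l}"] by simp
  qed
  also have "\<dots> \<le> flip_remainder g \<alpha> x"
    unfolding flip_remainder_def by (rule sum_le_suminf) auto
  finally show ?thesis
    using mult_right_mono[OF sum_flip_weights_le[of m], of \<alpha>] by (auto intro: order_trans add_right_mono add_left_mono)
qed

text \<open>Outside the stopping sets, exceeding \<open>3 * \<alpha>\<close> forces the remainder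
  above \<open>\<alpha>\<close> by \<open>flip_avg_le_flip_remainder\<close>. Doob's inequality for
  the stopping sets and Markov's inequality for the remainder contribute 1 and 2 to the constant
  3.\<close>

lemma flip_avg_weak_type:
  assumes [measurable]: "g \<in> borel_measurable dyadic_haar"
  shows "\<alpha> * emeasure dyadic_haar {x. \<exists>m. 3 * \<alpha> < flip_avg m g x} \<le> 3 * (\<integral>\<^sup>+ x. g x \<partial>dyadic_haar)"
proof -
  let ?O = "\<Union>l. first_exceed g \<alpha> l" and ?H = "{x \<in> space dyadic_haar. \<alpha> \<le> flip_remainder g \<alpha> x}"
  have "?H \<in> sets dyadic_haar" by measurable
  have O: "?O \<in> sets dyadic_haar" by auto
  have "{x. \<exists>m. 3 * \<alpha> < flip_avg m g x} \<subseteq> ?O \<union> ?H"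
  proof
    fix x assume "x \<in> {x. \<exists>m. 3 * \<alpha> < flip_avg m g x}"
    then obtain m where m: "3 * \<alpha> < flip_avg m g x" by blast
    show "x \<in> ?O \<union> ?H"
    proof (rule ccontr)
      assume *: "x \<notin> ?O \<union> ?H"
      then have "flip_remainder g \<alpha> x \<le> \<alpha>" by auto
      then have "2 * \<alpha> + flip_remainder g \<alpha> x \<le> 2 * \<alpha> + \<alpha>" by (rule add_left_mono)
      also have "\<dots> = 3 * \<alpha>" using distrib_right[of 2 1 \<alpha>] by simp
      finally show False using flip_avg_le_flip_remainder[of x g \<alpha> m] * m by auto
    qed
  qed
  then have "emeasure dyadic_haar {x. \<exists>m. 3 * \<alpha> < flip_avg m g x}
      \<le> emeasure dyadic_haar ?O + emeasure dyadic_haar ?H"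
    using O \<open>?H \<in> sets dyadic_haar\<close>
    by (intro order_trans[OF emeasure_mono emeasure_subadditive]) blast+
  then have "\<alpha> * emeasure dyadic_haar {x. \<exists>m. 3 * \<alpha> < flip_avg m g x}
      \<le> \<alpha> * emeasure dyadic_haar ?O + \<alpha> * emeasure dyadic_haar ?H"
    unfolding distrib_left[symmetric] by (rule mult_left_mono) simp
  also have "\<alpha> * emeasure dyadic_haar ?H = (\<integral>\<^sup>+ x. \<alpha> * indicator ?H x \<partial>dyadic_haar)"
    using \<open>?H \<in> sets dyadic_haar\<close> by (simp add: nn_integral_cmult_indicator)
  also have "\<dots> \<le> (\<integral>\<^sup>+ x. flip_remainder g \<alpha> x \<partial>dyadic_haar)"
    by (intro nn_integral_mono) (auto simp: indicator_def)
  also note nn_integral_flip_remainder_le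
  also note first_exceed_weak_type
  also have "(\<integral>\<^sup>+ x. g x \<partial>dyadic_haar) + 2 * (\<integral>\<^sup>+ x. g x \<partial>dyadic_haar) = 3 * (\<integral>\<^sup>+ x. g x \<partial>dyadic_haar)"
    using distrib_right[of 1 2 "\<integral>\<^sup>+ x. g x \<partial>dyadic_haar"] by simp
  finally show ?thesis by (simp add: add_right_mono)
qed

section \<open>Walsh-Lebesgue points\<close>

text \<open>The norm stands inside the average, so the condition also controls kernels of varying
  sign that are dominated by combinations of the \<open>flip_kernel m\<close>.\<close>

definition flip_lebesgue_point :: "(dyadic \<Rightarrow> 'b :: real_normed_vector) \<Rightarrow> dyadic \<Rightarrow> bool" where
  "flip_lebesgue_point f x \<longleftrightarrow> (\<lambda>m. flip_avg m (\<lambda>y. ennreal (norm (f y - f x))) x) \<longlonglongrightarrow> 0"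

text \<open>For m >= M, flips at j >= M stay in the cylinder on which f equals f x and contribute
  nothing. Flips at j < M have total weight at most 2^M / 2^m, which tends to 0, against averages
  bounded by B.\<close>

lemma flip_lebesgue_point_cyl:
  fixes f :: "dyadic \<Rightarrow> 'b :: real_normed_vector"
  assumes f: "\<And>y. (\<And>i. i < M \<Longrightarrow> y i = x i) \<Longrightarrow> f y = f x"
    and B: "\<And>y. norm (f y - f x) \<le> B" and B0: "0 \<le> B"
  shows "flip_lebesgue_point f x"
proof -
  let ?g = "\<lambda>y. ennreal (norm (f y - f x))"
  have le: "flip_avg m ?g x \<le> ennreal (2 ^ M * B * (1 / 2) ^ m)" if m: "M \<le> m" for m
  proof -
    have zero: "dyadic_avg m ?g (bit_flip j x) = 0" if "M \<le> j" for j
    proof -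
      have "?g y * ennreal (cyl_kernel m (bit_add (bit_flip j x) y)) = 0" for y
      proof (cases "\<forall>i<m. bit_flip j x i = y i")
        case True
        then have "y i = x i" if "i < M" for i
        proof -
          have "y i = bit_flip j x i" using True that m by simp
          also have "\<dots> = x i" using that \<open>M \<le> j\<close> by (simp add: bit_flip_def)
          finally show ?thesis .
        qed
        then have "f y = f x" by (rule f)
        then show ?thesis by simp
      next
        case False
        then have "cyl_kernel m (bit_add (bit_flip j x) y) = 0" by (simp only: cyl_kernel_bit_add if_False)
        then show ?thesis by simp
      qed
      then show ?thesis unfolding dyadic_avg_def by (simp only: nn_integral_const mult_zero_left)
    qed
    have bnd: "dyadic_avg m ?g z \<le> ennreal B" for z
    proof -
      have "dyadic_avg m ?g z \<le> dyadic_avg m (\<lambda>_. ennreal B) z"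
        by (intro dyadic_avg_mono ennreal_leI B)
      then show ?thesis by (simp add: dyadic_avg_const)
    qed
    have "flip_avg m ?g x = (\<Sum>j<M. ennreal (2 ^ j / 2 ^ m) * dyadic_avg m ?g (bit_flip j x))"
      unfolding flip_avg_def
      by (rule sum.mono_neutral_right) (use m in \<open>auto simp: zero not_less\<close>)
    also have "\<dots> \<le> (\<Sum>j<M. ennreal (2 ^ j / 2 ^ m) * ennreal B)"
      by (intro sum_mono mult_left_mono bnd) simp
    also have "\<dots> \<le> ennreal (2 ^ M / 2 ^ m) * ennreal B"
      unfolding sum_distrib_right[symmetric] by (intro mult_right_mono sum_power2_quotient_le) simp
    also have "\<dots> = ennreal (2 ^ M * B * (1 / 2) ^ m)"
      using B0 by (simp add: ennreal_mult[symmetric] power_one_over field_simps)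
    finally show ?thesis .
  qed
  have "(\<lambda>m. ennreal (2 ^ M * B * (1 / 2) ^ m)) \<longlonglongrightarrow> ennreal (2 ^ M * B * 0)"
    by (intro tendsto_ennrealI tendsto_mult tendsto_const LIMSEQ_power_zero) simp
  then have "(\<lambda>m. ennreal (2 ^ M * B * (1 / 2) ^ m)) \<longlonglongrightarrow> 0" by simp
  then show ?thesis
    unfolding flip_lebesgue_point_def
    by (rule tendsto_sandwich[OF _ _ tendsto_const, rotated 2])
      (auto intro!: le eventually_sequentiallyI[of M])
qed

lemma flip_lebesgue_point_scaleR_indicator_Compl:
  fixes c :: "'b :: real_normed_vector"
  shows "flip_lebesgue_point (\<lambda>x. indicator (UNIV - A) x *\<^sub>R c) x
    \<longleftrightarrow> flip_lebesgue_point (\<lambda>x. indicator A x *\<^sub>R c) x"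
proof -
  have "norm (indicator (UNIV - A) y *\<^sub>R c - indicator (UNIV - A) x *\<^sub>R c)
      = norm (indicator A y *\<^sub>R c - indicator A x *\<^sub>R c)" for y
    by (auto simp: indicator_def)
  then show ?thesis by (simp add: flip_lebesgue_point_def)
qed

lemma flip_lebesgue_point_add:
  fixes f g :: "dyadic \<Rightarrow> 'b :: {banach, second_countable_topology}"
  assumes [measurable]: "f \<in> borel_measurable dyadic_haar" "g \<in> borel_measurable dyadic_haar"
    and f: "flip_lebesgue_point f x" and g: "flip_lebesgue_point g x"
  shows "flip_lebesgue_point (\<lambda>x. f x + g x) x"
proof -
  have le: "flip_avg m (\<lambda>y. ennreal (norm (f y + g y - (f x + g x)))) x
      \<le> flip_avg m (\<lambda>y. ennreal (norm (f y - f x))) x + flip_avg m (\<lambda>y. ennreal (norm (g y - g x))) x" for m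
  proof -
    have "ennreal (norm (f y + g y - (f x + g x))) \<le> ennreal (norm (f y - f x)) + ennreal (norm (g y - g x))" for y
    proof -
      have "norm (f y + g y - (f x + g x)) \<le> norm (f y - f x) + norm (g y - g x)"
        by (metis add_diff_add norm_triangle_ineq)
      then show ?thesis by (simp add: ennreal_plus[symmetric] ennreal_leI del: ennreal_plus)
    qed
    then have "flip_avg m (\<lambda>y. ennreal (norm (f y + g y - (f x + g x)))) x
        \<le> flip_avg m (\<lambda>y. ennreal (norm (f y - f x)) + ennreal (norm (g y - g x))) x"
      by (rule flip_avg_mono)
    also have "\<dots> = flip_avg m (\<lambda>y. ennreal (norm (f y - f x))) x + flip_avg m (\<lambda>y. ennreal (norm (g y - g x))) x"
      by (rule flip_avg_add) measurable
    finally show ?thesis .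
  qed
  have "(\<lambda>m. flip_avg m (\<lambda>y. ennreal (norm (f y - f x))) x + flip_avg m (\<lambda>y. ennreal (norm (g y - g x))) x) \<longlonglongrightarrow> 0 + 0"
    using f g unfolding flip_lebesgue_point_def by (rule tendsto_add)
  then have lim: "(\<lambda>m. flip_avg m (\<lambda>y. ennreal (norm (f y - f x))) x + flip_avg m (\<lambda>y. ennreal (norm (g y - g x))) x) \<longlonglongrightarrow> 0"
    by simp
  show ?thesis
    unfolding flip_lebesgue_point_def
    by (rule tendsto_sandwich[OF _ _ tendsto_const lim]; intro always_eventually allI zero_le le)
qed

lemma AE_flip_lebesgue_point_add:
  fixes f g :: "dyadic \<Rightarrow> 'b :: {banach, second_countable_topology}"
  assumes "f \<in> borel_measurable dyadic_haar" "g \<in> borel_measurable dyadic_haar"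
    and "AE x in dyadic_haar. flip_lebesgue_point f x" "AE x in dyadic_haar. flip_lebesgue_point g x"
  shows "AE x in dyadic_haar. flip_lebesgue_point (\<lambda>x. f x + g x) x"
proof -
  have "AE x in dyadic_haar. flip_lebesgue_point f x \<and> flip_lebesgue_point g x"
    using assms(3,4) unfolding AE_conj_iff by blast
  then show ?thesis by (rule eventually_mono) (blast intro: flip_lebesgue_point_add assms(1,2))
qed

text \<open>A point that fails for every i lies in all the sets where either
  \<open>flip_avg m (h i)\<close> exceeds \<open>3 * \<alpha>\<close> for some m or h i reaches
  \<open>\<alpha>\<close>. By the weak type and Markov inequalities, \<open>\<alpha>\<close> times
  the measure of such a set is at most 3 + 1 times the integral of h i, which tends to 0.\<close>

lemma AE_flip_avg_small:
  fixes h :: "nat \<Rightarrow> dyadic \<Rightarrow> ennreal"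
  assumes [measurable]: "\<And>i. h i \<in> borel_measurable dyadic_haar"
    and lim: "(\<lambda>i. \<integral>\<^sup>+ x. h i x \<partial>dyadic_haar) \<longlonglongrightarrow> 0" and \<alpha>: "0 < \<alpha>"
  shows "AE x in dyadic_haar. \<exists>i. (\<forall>m. flip_avg m (h i) x \<le> 3 * \<alpha>) \<and> h i x \<le> \<alpha>"
proof -
  define A where "A i = {x \<in> space dyadic_haar. \<exists>m. 3 * \<alpha> < flip_avg m (h i) x}" for i
  define B where "B i = {x \<in> space dyadic_haar. \<alpha> \<le> h i x}" for i
  have [measurable]: "A i \<in> sets dyadic_haar" "B i \<in> sets dyadic_haar" for i
    unfolding A_def B_def by measurable
  let ?N = "\<Inter>i. A i \<union> B i"
  have N: "?N \<in> sets dyadic_haar" by measurable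
  have le: "\<alpha> * emeasure dyadic_haar ?N \<le> 4 * (\<integral>\<^sup>+ x. h i x \<partial>dyadic_haar)" for i
  proof -
    have "emeasure dyadic_haar ?N \<le> emeasure dyadic_haar (A i) + emeasure dyadic_haar (B i)"
      by (intro order_trans[OF emeasure_mono emeasure_subadditive]) auto
    then have "\<alpha> * emeasure dyadic_haar ?N \<le> \<alpha> * emeasure dyadic_haar (A i) + \<alpha> * emeasure dyadic_haar (B i)"
      unfolding distrib_left[symmetric] by (rule mult_left_mono) simp
    also have "\<alpha> * emeasure dyadic_haar (A i) \<le> 3 * (\<integral>\<^sup>+ x. h i x \<partial>dyadic_haar)"
      using flip_avg_weak_type[of "h i" \<alpha>] by (simp add: A_def)
    also have "\<alpha> * emeasure dyadic_haar (B i) = (\<integral>\<^sup>+ x. \<alpha> * indicator (B i) x \<partial>dyadic_haar)"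
      by (simp add: nn_integral_cmult_indicator)
    also have "\<dots> \<le> (\<integral>\<^sup>+ x. h i x \<partial>dyadic_haar)"
      by (intro nn_integral_mono) (auto simp: indicator_def B_def)
    also have "3 * (\<integral>\<^sup>+ x. h i x \<partial>dyadic_haar) + (\<integral>\<^sup>+ x. h i x \<partial>dyadic_haar) = 4 * (\<integral>\<^sup>+ x. h i x \<partial>dyadic_haar)"
      using distrib_right[of 3 1 "\<integral>\<^sup>+ x. h i x \<partial>dyadic_haar"] by simp
    finally show ?thesis by (simp add: add_right_mono add_left_mono)
  qed
  have "(\<lambda>i. 4 * (\<integral>\<^sup>+ x. h i x \<partial>dyadic_haar)) \<longlonglongrightarrow> 4 * 0"
    by (intro ennreal_tendsto_cmult lim) simp
  then have "\<alpha> * emeasure dyadic_haar ?N \<le> 4 * 0"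
    by (rule LIMSEQ_le_const) (auto intro: le)
  then have "emeasure dyadic_haar ?N = 0" using \<alpha> by (auto simp: less_le)
  then have "?N \<in> null_sets dyadic_haar" using N by (intro null_setsI)
  then show ?thesis
    by (rule AE_I') (auto simp: A_def B_def not_le not_less)
qed

text \<open>The density argument: f y - f x is compared with s i y - s i x, and the errors at y and
  at x are made small by \<open>AE_flip_avg_small\<close>. The index i may depend on the point x and
  on the required accuracy.\<close>

lemma AE_flip_lebesgue_point_limit:
  fixes f :: "dyadic \<Rightarrow> 'b :: {banach, second_countable_topology}"
  assumes [measurable]: "f \<in> borel_measurable dyadic_haar" "\<And>i. s i \<in> borel_measurable dyadic_haar"
    and s: "\<And>i. AE x in dyadic_haar. flip_lebesgue_point (s i) x"
    and lim: "(\<lambda>i. \<integral>\<^sup>+ x. ennreal (norm (f x - s i x)) \<partial>dyadic_haar) \<longlonglongrightarrow> 0"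
  shows "AE x in dyadic_haar. flip_lebesgue_point f x"
proof -
  let ?h = "\<lambda>i x. ennreal (norm (f x - s i x))"
  \<comment> \<open>Countably many thresholds 1 / (p + 1) suffice, so a single null set serves all
    of them.\<close>
  have "AE x in dyadic_haar. \<forall>p. \<exists>i. (\<forall>m. flip_avg m (?h i) x \<le> 3 * ennreal (1 / Suc p)) \<and> ?h i x \<le> ennreal (1 / Suc p)"
    unfolding AE_all_countable by (intro allI AE_flip_avg_small lim) (auto simp: ennreal_zero_less_divide)
  moreover have "AE x in dyadic_haar. \<forall>i. flip_lebesgue_point (s i) x"
    unfolding AE_all_countable using s by blast
  ultimately show ?thesis
  proof eventually_elim
    case (elim x)
    show ?case
      unfolding flip_lebesgue_point_def
    proof (rule order_tendstoI)
      fix e :: ennreal assume e: "0 < e"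
      \<comment> \<open>The constant 6 is 1 + 3 + 2: the Lebesgue point of s i, the bound on the
        averaged error, and the constant error at x times the total weight, at most 2, of a flip
        average.\<close>
      have "(\<lambda>p. ennreal (6 * inverse (real (Suc p)))) \<longlonglongrightarrow> ennreal (6 * 0)"
        by (intro tendsto_ennrealI tendsto_mult tendsto_const LIMSEQ_inverse_real_of_nat)
      then have "eventually (\<lambda>p. ennreal (6 * inverse (real (Suc p))) < e) sequentially"
        using e by (intro order_tendstoD(2)[where a = e]) auto
      then obtain p where p: "ennreal (6 * inverse (real (Suc p))) < e"
        by (auto simp: eventually_sequentially)
      define \<alpha> where "\<alpha> = ennreal (1 / Suc p)"
      have \<alpha>: "0 < \<alpha>" "6 * \<alpha> < e"
        using p by (auto simp: \<alpha>_def ennreal_mult divide_inverse)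
      obtain i where i: "\<And>m. flip_avg m (?h i) x \<le> 3 * \<alpha>" "?h i x \<le> \<alpha>"
        using elim(1) unfolding \<alpha>_def by blast
      have "eventually (\<lambda>m. flip_avg m (\<lambda>y. ennreal (norm (s i y - s i x))) x < \<alpha>) sequentially"
        using elim(2) \<alpha>(1) unfolding flip_lebesgue_point_def by (intro order_tendstoD(2)[where y = 0]) auto
      then show "eventually (\<lambda>m. flip_avg m (\<lambda>y. ennreal (norm (f y - f x))) x < e) sequentially"
      proof eventually_elim
        case (elim m)
        have tri: "ennreal (norm (f y - f x)) \<le> (ennreal (norm (s i y - s i x)) + ?h i y) + ?h i x" for y
        proof -
          have "f y - f x = (s i y - s i x) + (f y - s i y) - (f x - s i x)" by simp
          then have "norm (f y - f x) = norm ((s i y - s i x) + (f y - s i y) - (f x - s i x))"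
            by (rule arg_cong)
          also have "\<dots> \<le> norm ((s i y - s i x) + (f y - s i y)) + norm (f x - s i x)"
            by (rule norm_triangle_ineq4)
          also have "norm ((s i y - s i x) + (f y - s i y)) \<le> norm (s i y - s i x) + norm (f y - s i y)"
            by (rule norm_triangle_ineq)
          finally have "norm (f y - f x) \<le> norm (s i y - s i x) + norm (f y - s i y) + norm (f x - s i x)"
            by simp
          then show ?thesis by (simp add: ennreal_plus[symmetric] ennreal_leI del: ennreal_plus)
        qed
        have "flip_avg m (\<lambda>y. ennreal (norm (f y - f x))) x
            \<le> flip_avg m (\<lambda>y. (ennreal (norm (s i y - s i x)) + ?h i y) + ?h i x) x"
          by (rule flip_avg_mono[OF tri])
        also have "\<dots> = flip_avg m (\<lambda>y. ennreal (norm (s i y - s i x))) x + flip_avg m (?h i) x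
            + flip_avg m (\<lambda>y. ?h i x) x"
          by (simp add: flip_avg_add)
        also have "\<dots> \<le> \<alpha> + 3 * \<alpha> + 2 * \<alpha>"
        proof (intro add_mono)
          show "flip_avg m (\<lambda>y. ?h i x) x \<le> 2 * \<alpha>"
            by (rule order_trans[OF flip_avg_const_le mult_left_mono[OF i(2)]]) simp
        qed (use i elim in auto)
        also have "\<dots> = 6 * \<alpha>"
          using distrib_right[of 1 3 \<alpha>] distrib_right[of 4 2 \<alpha>] by simp
        finally show ?case using \<alpha>(2) by simp
      qed
    qed simp
  qed
qed

text \<open>Dynkin induction from cylinder sets, for which every point is good by
  \<open>flip_lebesgue_point_cyl\<close>. Complements only change signs of differences, and a
  countable disjoint union is an L1 limit of finite ones.\<close>

lemma AE_flip_lebesgue_point_indicator: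
  fixes c :: "'b :: {banach, second_countable_topology}"
  assumes "A \<in> sets dyadic_haar"
  shows "AE x in dyadic_haar. flip_lebesgue_point (\<lambda>x. indicator A x *\<^sub>R c) x"
proof -
  let ?M = "\<lambda>_::nat. uniform_count_measure (UNIV :: bit set)"
  let ?P = "\<lambda>A. AE x in dyadic_haar. flip_lebesgue_point (\<lambda>x. indicator A x *\<^sub>R c) x"
  have sets: "sets dyadic_haar = sigma_sets UNIV (prod_algebra UNIV ?M)"
    unfolding dyadic_haar_def sets_PiM by (simp add: space_uniform_count_measure)
  have "Int_stable (prod_algebra UNIV ?M)" by (rule Int_stable_prod_algebra)
  moreover have "prod_algebra UNIV ?M \<subseteq> Pow UNIV" by simp
  moreover have "A \<in> sigma_sets UNIV (prod_algebra UNIV ?M)" using assms sets by simp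
  ultimately show ?thesis
  proof (induction rule: sigma_sets_induct_disjoint)
    case (basic A)
    then obtain J E where A: "A = prod_emb UNIV ?M J (\<Pi>\<^sub>E j\<in>J. E j)" and J: "finite J"
      by (rule prod_algebraE)
    have "\<exists>M. \<forall>j\<in>J. j < M" using J by (simp only: finite_nat_set_iff_bounded)
    then obtain M where M: "\<And>j. j \<in> J \<Longrightarrow> j < M" by blast
    have mem: "y \<in> A \<longleftrightarrow> (\<forall>j\<in>J. y j \<in> E j)" for y
      unfolding A by (auto simp: prod_emb_def space_uniform_count_measure PiE_iff)
    have "flip_lebesgue_point (\<lambda>x. indicator A x *\<^sub>R c) x" for x
    proof (rule flip_lebesgue_point_cyl[where M = M and B = "norm c"])
      fix y assume "\<And>i. i < M \<Longrightarrow> y i = x i"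
      then have "y \<in> A \<longleftrightarrow> x \<in> A" using M by (simp add: mem)
      then show "indicator A y *\<^sub>R c = indicator A x *\<^sub>R c" by (simp add: indicator_def)
    qed (auto simp: indicator_def)
    then show ?case by simp
  next
    case empty
    show ?case by (auto intro!: flip_lebesgue_point_cyl[where B = 0])
  next
    case (compl A)
    then show ?case by (simp add: flip_lebesgue_point_scaleR_indicator_Compl)
  next
    case (union A)
    have A [measurable]: "A i \<in> sets dyadic_haar" for i using union(2) sets by auto
    have step: "?P (\<Union>i<n. A i)" for n
    proof (induction n)
      case 0
      show ?case by (auto intro!: flip_lebesgue_point_cyl[where B = 0])
    next
      case (Suc n)
      have "A n \<inter> A i = {}" if "i < n" for i
        using union(1) that by (simp add: disjoint_family_on_def)
      then have "A n \<inter> (\<Union>i<n. A i) = {}" by blast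
      then have eq: "(\<lambda>x. indicator (\<Union>i<Suc n. A i) x *\<^sub>R c)
          = (\<lambda>x. indicator (\<Union>i<n. A i) x *\<^sub>R c + indicator (A n) x *\<^sub>R c)"
        by (auto simp: fun_eq_iff indicator_def less_Suc_eq)
      show ?case
        unfolding eq using Suc union(3)[of n] by (intro AE_flip_lebesgue_point_add) auto
    qed
    show ?case
    proof (rule AE_flip_lebesgue_point_limit[OF _ _ step])
      let ?U = "\<Union>i. A i"
      \<comment> \<open>Continuity from above: the parts of the union not yet covered decrease to
        the empty set.\<close>
      have "(\<lambda>n. emeasure dyadic_haar (?U - (\<Union>i<n. A i))) \<longlonglongrightarrow> emeasure dyadic_haar (\<Inter>n. ?U - (\<Union>i<n. A i))"
        by (intro Lim_emeasure_decseq) (auto simp: decseq_def intro: less_le_trans)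
      moreover have "(\<Inter>n. ?U - (\<Union>i<n. A i)) = {}" by auto
      ultimately have "(\<lambda>n. emeasure dyadic_haar (?U - (\<Union>i<n. A i))) \<longlonglongrightarrow> 0"
        by (simp only: emeasure_empty)
      then have "(\<lambda>n. ennreal (norm c) * emeasure dyadic_haar (?U - (\<Union>i<n. A i))) \<longlonglongrightarrow> ennreal (norm c) * 0"
        by (intro ennreal_tendsto_cmult) auto
      then have "(\<lambda>n. ennreal (norm c) * emeasure dyadic_haar (?U - (\<Union>i<n. A i))) \<longlonglongrightarrow> 0"
        by (simp only: mult_zero_right)
      moreover have "(\<integral>\<^sup>+ x. ennreal (norm (indicator ?U x *\<^sub>R c - indicator (\<Union>i<n. A i) x *\<^sub>R c)) \<partial>dyadic_haar)
          = ennreal (norm c) * emeasure dyadic_haar (?U - (\<Union>i<n. A i))" for n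
        by (subst nn_integral_cmult_indicator[symmetric])
          (auto intro!: nn_integral_cong simp: indicator_def)
      ultimately show "(\<lambda>n. \<integral>\<^sup>+ x. ennreal (norm (indicator ?U x *\<^sub>R c - indicator (\<Union>i<n. A i) x *\<^sub>R c)) \<partial>dyadic_haar) \<longlonglongrightarrow> 0"
        by (simp only:)
    qed measurable
  qed
qed

lemma AE_flip_lebesgue_point:
  fixes f :: "dyadic \<Rightarrow> 'b :: {banach, second_countable_topology}"
  assumes "integrable dyadic_haar f"
  shows "AE x in dyadic_haar. flip_lebesgue_point f x"
  using assms
proof (induction rule: integrable_induct)
  case (base A c)
  then show ?case by (intro AE_flip_lebesgue_point_indicator)
next
  case (add f g)
  have "f \<in> borel_measurable dyadic_haar" "g \<in> borel_measurable dyadic_haar"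
    using add by auto
  with add show ?case by (intro AE_flip_lebesgue_point_add)
next
  case (lim f s)
  have [measurable]: "f \<in> borel_measurable dyadic_haar" "\<And>i. s i \<in> borel_measurable dyadic_haar"
    using lim by auto
  show ?case
  proof (rule AE_flip_lebesgue_point_limit[OF _ _ lim.IH])
    have "(\<lambda>i. \<integral>\<^sup>+ x. ennreal (norm (f x - s i x)) \<partial>dyadic_haar) \<longlonglongrightarrow> (\<integral>\<^sup>+ x. 0 \<partial>dyadic_haar)"
    proof (rule nn_integral_dominated_convergence[where w = "\<lambda>x. ennreal (3 * norm (f x))"])
      fix i
      \<comment> \<open>The approximating sequence of \<open>integrable_induct\<close> satisfies
        norm (s i x) <= 2 * norm (f x), hence the factor 3 = 1 + 2.\<close>
      have "norm (f x - s i x) \<le> 3 * norm (f x)" for x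
        using norm_triangle_ineq4[of "f x" "s i x"] lim.hyps(3)[of x i] by simp
      then show "AE x in dyadic_haar. ennreal (norm (f x - s i x)) \<le> ennreal (3 * norm (f x))"
        by (simp add: ennreal_leI)
    next
      have "integrable dyadic_haar (\<lambda>x. 3 * norm (f x))" using lim.hyps(4) by simp
      then show "(\<integral>\<^sup>+ x. ennreal (3 * norm (f x)) \<partial>dyadic_haar) < \<infinity>"
        by (subst nn_integral_eq_integral) auto
    next
      have "(\<lambda>i. ennreal (norm (f x - s i x))) \<longlonglongrightarrow> ennreal (norm (f x - f x))" for x
        using lim.hyps(2)[of x] by (intro tendsto_ennrealI tendsto_norm tendsto_diff tendsto_const) simp
      then show "AE x in dyadic_haar. (\<lambda>i. ennreal (norm (f x - s i x))) \<longlonglongrightarrow> 0" by simp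
    qed measurable
    then show "(\<lambda>i. \<integral>\<^sup>+ x. ennreal (norm (f x - s i x)) \<partial>dyadic_haar) \<longlonglongrightarrow> 0" by simp
  qed measurable
qed

section \<open>Convergence of Norlund means\<close>

text \<open>A Toeplitz lemma: the finitely many columns i < M, where A may be large, tend to 0; the
  remaining ones are controlled by the smallness of A and the bounded row sums.\<close>

lemma tendsto_weighted_sum_0:
  fixes A :: "nat \<Rightarrow> real" and \<beta> :: "nat \<Rightarrow> nat \<Rightarrow> real" and m :: "nat \<Rightarrow> nat"
  assumes A: "A \<longlonglongrightarrow> 0" and \<beta>0: "\<And>i. (\<lambda>n. \<beta> n i) \<longlonglongrightarrow> 0"
    and nonneg: "\<And>n i. 0 \<le> \<beta> n i" and bound: "eventually (\<lambda>n. (\<Sum>i<m n. \<beta> n i) \<le> C) sequentially"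
  shows "(\<lambda>n. \<Sum>i<m n. \<beta> n i * \<bar>A i\<bar>) \<longlonglongrightarrow> 0"
proof (rule order_tendstoI)
  fix e :: real assume "e < 0"
  then show "eventually (\<lambda>n. e < (\<Sum>i<m n. \<beta> n i * \<bar>A i\<bar>)) sequentially"
    using nonneg by (auto intro!: always_eventually less_le_trans[OF _ sum_nonneg])
next
  fix e :: real assume e: "0 < e"
  \<comment> \<open>Taking \<open>\<bar>C\<bar> + 1\<close> instead of C keeps the denominator
    positive for every real C.\<close>
  define d where "d = e / (2 * (\<bar>C\<bar> + 1))"
  have d: "0 < d" using e by (simp add: d_def)
  obtain M where M: "\<And>i. M \<le> i \<Longrightarrow> \<bar>A i\<bar> < d"
    using A d by (auto simp: LIMSEQ_iff)
  have "(\<lambda>n. \<Sum>i<M. \<beta> n i * \<bar>A i\<bar>) \<longlonglongrightarrow> (\<Sum>i<M. 0 * \<bar>A i\<bar>)"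
    by (intro tendsto_sum tendsto_mult \<beta>0 tendsto_const)
  then have "eventually (\<lambda>n. (\<Sum>i<M. \<beta> n i * \<bar>A i\<bar>) < e / 2) sequentially"
    using e by (intro order_tendstoD(2)[where a = "e / 2"]) auto
  with bound show "eventually (\<lambda>n. (\<Sum>i<m n. \<beta> n i * \<bar>A i\<bar>) < e) sequentially"
  proof eventually_elim
    case (elim n)
    have "(\<Sum>i<m n. \<beta> n i * \<bar>A i\<bar>) \<le> (\<Sum>i<m n. (if i < M then \<beta> n i * \<bar>A i\<bar> else 0) + \<beta> n i * d)"
    proof (intro sum_mono)
      fix i
      show "\<beta> n i * \<bar>A i\<bar> \<le> (if i < M then \<beta> n i * \<bar>A i\<bar> else 0) + \<beta> n i * d"
        using nonneg[of n i] d M[of i] by (auto intro!: mult_left_mono)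
    qed
    also have "\<dots> = (\<Sum>i\<in>{..<m n} \<inter> {..<M}. \<beta> n i * \<bar>A i\<bar>) + (\<Sum>i<m n. \<beta> n i) * d"
      by (simp add: sum.distrib sum_distrib_right sum.inter_restrict)
    also have "\<dots> \<le> (\<Sum>i<M. \<beta> n i * \<bar>A i\<bar>) + (\<bar>C\<bar> + 1) * d"
      using nonneg elim d by (intro add_mono sum_mono2 mult_right_mono) auto
    also have "(\<bar>C\<bar> + 1) * d = e / 2" by (simp add: d_def field_simps)
    finally show ?case using elim by simp
  qed
qed

text \<open>The range type stays general because both the complex f and the real function
  \<open>norm (f y - f x)\<close> get multiplied by bounded kernels.\<close>

lemma integrable_mult_bounded_real:
  fixes f :: "dyadic \<Rightarrow> 'b :: {real_normed_algebra_1, banach, second_countable_topology}"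
  assumes f: "integrable dyadic_haar f" and [measurable]: "K \<in> borel_measurable dyadic_haar"
    and K: "\<And>y. \<bar>K y\<bar> \<le> C"
  shows "integrable dyadic_haar (\<lambda>y. f y * of_real (K y))"
proof (rule Bochner_Integration.integrable_bound)
  show "integrable dyadic_haar (\<lambda>y. C *\<^sub>R f y)" using f by simp
  have [measurable]: "f \<in> borel_measurable dyadic_haar" using f by simp
  have "(\<lambda>y. K y *\<^sub>R f y) \<in> borel_measurable dyadic_haar" by measurable
  then show "(\<lambda>y. f y * of_real (K y)) \<in> borel_measurable dyadic_haar"
    by (simp add: of_real_def)
  have "norm (f y * of_real (K y)) \<le> norm (C *\<^sub>R f y)" for y
  proof -
    have "norm (f y * of_real (K y)) = norm (f y) * \<bar>K y\<bar>" by (simp add: of_real_def)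
    also have "\<dots> \<le> norm (f y) * \<bar>C\<bar>" by (rule mult_left_mono) (use K[of y] in auto)
    finally show ?thesis by (simp add: mult.commute)
  qed
  then show "AE y in dyadic_haar. norm (f y * of_real (K y)) \<le> norm (C *\<^sub>R f y)" by simp
qed

section \<open>Integral representation and estimates of the means\<close>

lemma abs_dirichlet_le_of_nat: "\<bar>dirichlet k t\<bar> \<le> real k"
  unfolding dirichlet_def using sum_abs[of "\<lambda>i. walsh i t" "{..<k}"] by (simp add: abs_walsh)

lemma integrable_mult_dirichlet:
  fixes f :: "dyadic \<Rightarrow> complex"
  assumes "integrable dyadic_haar f"
  shows "integrable dyadic_haar (\<lambda>y. f y * of_real (dirichlet k (bit_add x y)))"
  by (rule integrable_mult_bounded_real[OF assms]) (auto intro: abs_dirichlet_le_of_nat)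

lemma walsh_partial_sum_dirichlet:
  assumes f: "integrable dyadic_haar f"
  shows "walsh_partial_sum f k x = (\<integral>y. f y * of_real (dirichlet k (bit_add x y)) \<partial>dyadic_haar)"
proof -
  have int: "integrable dyadic_haar (\<lambda>y. f y * of_real (walsh i y))" for i
    by (rule integrable_mult_bounded_real[OF f, where C = 1]) (auto simp: abs_walsh)
  have "f y * of_real (dirichlet k (bit_add x y))
      = (\<Sum>i<k. f y * of_real (walsh i y) * of_real (walsh i x))" for y
    by (simp add: dirichlet_bit_add sum_distrib_left mult_ac)
  then have "(\<integral>y. f y * of_real (dirichlet k (bit_add x y)) \<partial>dyadic_haar)
      = (\<Sum>i<k. \<integral>y. f y * of_real (walsh i y) * of_real (walsh i x) \<partial>dyadic_haar)"
    using int by simp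
  also have "\<dots> = walsh_partial_sum f k x"
    by (simp add: walsh_partial_sum_def walsh_coeff_def)
  finally show ?thesis ..
qed

text \<open>For k > 0 the Dirichlet kernel has mean 1, so the constant f x can be absorbed into the
  integral.\<close>

lemma walsh_partial_sum_diff:
  assumes f: "integrable dyadic_haar f" and k: "0 < k"
  shows "walsh_partial_sum f k x - f x
    = (\<integral>y. (f y - f x) * of_real (dirichlet k (bit_add x y)) \<partial>dyadic_haar)"
proof -
  have c: "integrable dyadic_haar (\<lambda>y. f x * of_real (dirichlet k (bit_add x y)))"
    by (rule integrable_mult_dirichlet) simp
  have "integrable dyadic_haar (\<lambda>y. dirichlet k (bit_add x y))"
    by (simp add: dirichlet_bit_add integrable_walsh)
  then have "(\<integral>y. f x * of_real (dirichlet k (bit_add x y)) \<partial>dyadic_haar) = f x"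
    using integral_dirichlet[OF k, of x] by simp
  then show ?thesis
    using integrable_mult_dirichlet[OF f] c
    by (simp add: left_diff_distrib walsh_partial_sum_dirichlet[OF f])
qed

lemma norlund_mean_diff:
  assumes f: "integrable dyadic_haar f" and Q: "0 < norlund_weight q n"
  shows "norlund_mean q f n x - f x = of_real (1 / norlund_weight q n) *
    (\<integral>y. (f y - f x) * of_real (\<Sum>k=1..n. q (n - k) * dirichlet k (bit_add x y)) \<partial>dyadic_haar)"
proof -
  \<comment> \<open>Reversing the order k -> n - k shows that the weights of the mean add up to its
    denominator, so f x can be subtracted term by term.\<close>
  have Q_eq: "norlund_weight q n = (\<Sum>k=1..n. q (n - k))"
    unfolding norlund_weight_def
    by (rule sum.reindex_bij_witness[where i = "\<lambda>k. n - k" and j = "\<lambda>k. n - k"]) auto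
  have int: "integrable dyadic_haar (\<lambda>y. (f y - f x) * of_real (dirichlet k (bit_add x y)))" for k
    by (rule integrable_mult_dirichlet) (use f in simp)
  have "(f y - f x) * of_real (\<Sum>k=1..n. q (n - k) * dirichlet k (bit_add x y))
      = (\<Sum>k=1..n. of_real (q (n - k)) * ((f y - f x) * of_real (dirichlet k (bit_add x y))))" for y
    by (simp add: sum_distrib_left mult_ac)
  then have "(\<integral>y. (f y - f x) * of_real (\<Sum>k=1..n. q (n - k) * dirichlet k (bit_add x y)) \<partial>dyadic_haar)
      = (\<Sum>k=1..n. \<integral>y. of_real (q (n - k)) * ((f y - f x) * of_real (dirichlet k (bit_add x y))) \<partial>dyadic_haar)"
    using int by (simp only:) (rule Bochner_Integration.integral_sum, simp)
  also have "\<dots> = (\<Sum>k=1..n. of_real (q (n - k)) * (walsh_partial_sum f k x - f x))"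
    by (intro sum.cong refl) (simp add: walsh_partial_sum_diff[OF f])
  also have "\<dots> = (\<Sum>k=1..n. of_real (q (n - k)) * walsh_partial_sum f k x) - of_real (norlund_weight q n) * f x"
    by (simp add: Q_eq right_diff_distrib sum_subtractf sum_distrib_right)
  finally show ?thesis
    using Q by (simp add: norlund_mean_def field_simps)
qed

lemma flip_kernel_bounded: "\<bar>flip_kernel m t\<bar> \<le> (\<Sum>j\<le>m. 2 ^ j)"
proof -
  have "flip_kernel m t \<le> (\<Sum>j\<le>m. 2 ^ j / 2 ^ m * 2 ^ m)"
    unfolding flip_kernel_def by (intro sum_mono mult_left_mono) (auto simp: cyl_kernel_def)
  then show ?thesis by (simp add: flip_kernel_nonneg)
qed

text \<open>Since \<open>flip_kernel m\<close> is bounded, the average in \<open>ennreal\<close> is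
  the value of a finite real integral, and the limit transfers.\<close>

lemma flip_lebesgue_point_integral_tendsto:
  fixes f :: "dyadic \<Rightarrow> complex"
  assumes f: "integrable dyadic_haar f" and x: "flip_lebesgue_point f x"
  shows "(\<lambda>m. \<integral>y. norm (f y - f x) * flip_kernel m (bit_add x y) \<partial>dyadic_haar) \<longlonglongrightarrow> 0"
proof -
  have [measurable]: "f \<in> borel_measurable dyadic_haar" using f by simp
  have "integrable dyadic_haar (\<lambda>y. norm (f y - f x) * of_real (flip_kernel m (bit_add x y)))" for m
    by (rule integrable_mult_bounded_real) (use f in \<open>auto intro: flip_kernel_bounded\<close>)
  then have int: "integrable dyadic_haar (\<lambda>y. norm (f y - f x) * flip_kernel m (bit_add x y))" for m
    by simp
  have "flip_avg m (\<lambda>y. ennreal (norm (f y - f x))) x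
      = ennreal (\<integral>y. norm (f y - f x) * flip_kernel m (bit_add x y) \<partial>dyadic_haar)" for m
    using int[of m]
    by (simp add: flip_avg_kernel ennreal_mult[symmetric] flip_kernel_nonneg nn_integral_eq_integral)
  then have "(\<lambda>m. ennreal (\<integral>y. norm (f y - f x) * flip_kernel m (bit_add x y) \<partial>dyadic_haar)) \<longlonglongrightarrow> ennreal 0"
    using x by (simp add: flip_lebesgue_point_def)
  then show ?thesis
    by (rule tendsto_ennrealD) (auto intro!: always_eventually integral_nonneg_AE simp: flip_kernel_nonneg)
qed

text \<open>The pointwise bound \<open>abs_norlund_kernel_le\<close>, integrated against
  \<open>norm (f y - f x)\<close> and divided by the weight, reduces convergence of the means to a
  statement about the numbers A i.\<close>

lemma norm_norlund_mean_diff_le: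
  fixes f :: "dyadic \<Rightarrow> complex" and q :: "nat \<Rightarrow> real" and x :: dyadic
  assumes f: "integrable dyadic_haar f"
    and r: "r < 2 ^ m" and n: "n = 2 ^ m + r"
    and nonneg: "\<And>k. 0 \<le> q k" and noninc: "\<And>k. q (Suc k) \<le> q k"
    and Q: "0 < norlund_weight q n"
  defines "A \<equiv> \<lambda>i. \<integral>y. norm (f y - f x) * flip_kernel i (bit_add x y) \<partial>dyadic_haar"
  shows "norm (norlund_mean q f n x - f x)
    \<le> A m + (\<Sum>i<m. (2 * 2 ^ i * q (r + 2 ^ i) + q 0 * real r) / norlund_weight q n * A i)"
proof -
  let ?Q = "norlund_weight q n" and ?K = "\<lambda>y. \<Sum>k=1..n. q (n - k) * dirichlet k (bit_add x y)"
  let ?b = "\<lambda>i. 2 * 2 ^ i * q (r + 2 ^ i) + q 0 * real r"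
  have "integrable dyadic_haar (\<lambda>y. norm (f y - f x) * of_real (flip_kernel m (bit_add x y)))" for m
    by (rule integrable_mult_bounded_real) (use f in \<open>auto intro: flip_kernel_bounded\<close>)
  then have int: "integrable dyadic_haar (\<lambda>y. norm (f y - f x) * flip_kernel m (bit_add x y))" for m
    by simp
  have "norm (\<integral>y. (f y - f x) * of_real (?K y) \<partial>dyadic_haar)
      \<le> (\<integral>y. ?Q * (norm (f y - f x) * flip_kernel m (bit_add x y))
          + (\<Sum>i<m. ?b i * (norm (f y - f x) * flip_kernel i (bit_add x y))) \<partial>dyadic_haar)"
  proof (rule order_trans[OF Bochner_Integration.integral_norm_bound Bochner_Integration.integral_mono])
    have "\<bar>?K y\<bar> \<le> (\<Sum>k=1..n. \<bar>q (n - k)\<bar> * real k)" for y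
      by (rule order_trans[OF sum_abs])
        (auto simp: abs_mult intro!: sum_mono mult_left_mono abs_dirichlet_le_of_nat)
    then have "integrable dyadic_haar (\<lambda>y. (f y - f x) * of_real (?K y))"
      by (intro integrable_mult_bounded_real) (use f in auto)
    then show "integrable dyadic_haar (\<lambda>y. norm ((f y - f x) * of_real (?K y)))"
      by (rule integrable_norm)
    show "integrable dyadic_haar (\<lambda>y. ?Q * (norm (f y - f x) * flip_kernel m (bit_add x y))
          + (\<Sum>i<m. ?b i * (norm (f y - f x) * flip_kernel i (bit_add x y))))"
      by (intro Bochner_Integration.integrable_add Bochner_Integration.integrable_sum
          integrable_mult_right int)
    fix y
    have "norm ((f y - f x) * of_real (?K y)) = norm (f y - f x) * \<bar>?K y\<bar>"
      by (simp only: norm_mult norm_of_real)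
    also have "\<dots> \<le> norm (f y - f x) * (?Q * flip_kernel m (bit_add x y)
        + (\<Sum>i<m. ?b i * flip_kernel i (bit_add x y)))"
      by (intro mult_left_mono abs_norlund_kernel_le r n nonneg noninc) simp
    also have "\<dots> = ?Q * (norm (f y - f x) * flip_kernel m (bit_add x y))
          + (\<Sum>i<m. ?b i * (norm (f y - f x) * flip_kernel i (bit_add x y)))"
      unfolding distrib_left sum_distrib_left by (simp only: mult.left_commute)
    finally show "norm ((f y - f x) * of_real (?K y)) \<le> \<dots>" .
  qed
  also have "\<dots> = ?Q * A m + (\<Sum>i<m. ?b i * A i)"
    unfolding A_def
    by (subst Bochner_Integration.integral_add)
      (auto intro!: Bochner_Integration.integrable_sum integrable_mult_right int
        simp: Bochner_Integration.integral_sum int)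
  finally have "norm (\<integral>y. (f y - f x) * of_real (?K y) \<partial>dyadic_haar) \<le> ?Q * A m + (\<Sum>i<m. ?b i * A i)" .
  moreover have "norm (norlund_mean q f n x - f x)
      = norm (\<integral>y. (f y - f x) * of_real (?K y) \<partial>dyadic_haar) / ?Q"
    unfolding norlund_mean_diff[OF f Q] using Q by (simp add: norm_mult norm_divide del: of_real_sum)
  ultimately have "norm (norlund_mean q f n x - f x) \<le> (?Q * A m + (\<Sum>i<m. ?b i * A i)) / ?Q"
    using Q by (simp add: divide_right_mono)
  also have "\<dots> = A m + (\<Sum>i<m. ?b i / ?Q * A i)"
  proof -
    have "(?Q * A m + s) / ?Q = A m + s / ?Q" for s using Q by (simp add: add_divide_distrib)
    then show ?thesis by (simp add: sum_divide_distrib)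
  qed
  finally show ?thesis .
qed

text \<open>Condensation of the shifted sequence q (r + j) up to j = 2^(m-1) gives a factor 2
  besides the explicit one; the indices r + 1, ..., r + 2^(m-1) are distinct and lie below
  n.\<close>

lemma flip_coefficients_sum_le:
  fixes q :: "nat \<Rightarrow> real"
  assumes n: "n = 2 ^ m + r" and nonneg: "\<And>k. 0 \<le> q k" and noninc: "\<And>k. q (Suc k) \<le> q k"
  shows "(\<Sum>i<m. 2 * 2 ^ i * q (r + 2 ^ i)) \<le> 4 * norlund_weight q n"
proof (cases m)
  case 0
  then show ?thesis using nonneg by (simp add: norlund_weight_def sum_nonneg)
next
  case (Suc p)
  have mono: "q (r + j) \<le> q (r + i)" if "i \<le> j" for i j
    by (rule lift_Suc_antimono_le[of q]) (use noninc that in auto)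
  have "(\<Sum>i<m. 2 ^ i * q (r + 2 ^ i)) \<le> 2 * (\<Sum>j=1..2 ^ p. q (r + j))"
    using sum_condensation_le[of "\<lambda>j. q (r + j)" p] nonneg mono
    by (simp add: Suc lessThan_Suc_atMost)
  also have "(\<Sum>j=1..2 ^ p. q (r + j)) = (\<Sum>k\<in>(\<lambda>j. r + j) ` {1..2 ^ p}. q k)"
    by (subst sum.reindex) auto
  also have "\<dots> \<le> norlund_weight q n"
    unfolding norlund_weight_def using nonneg
    by (intro sum_mono2) (auto simp: n Suc intro: le_less_trans)
  finally show ?thesis by (simp add: sum_distrib_left[symmetric] mult.assoc)
qed

theorem theorem11:
  fixes q :: "nat \<Rightarrow> real" and a :: "nat \<Rightarrow> nat" and c :: real and f :: "dyadic \<Rightarrow> complex"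
  assumes q_nonneg: "\<And>k. 0 \<le> q k"
    and q_noninc: "\<And>k. q (Suc k) \<le> q k"
    and q_convex: "\<And>k. 2 * q (k + 1) \<le> q k + q (k + 2)"
    and q0: "0 < q 0"
    and Q_lim: "filterlim (norlund_weight q) at_top sequentially"
    and a_pos: "\<And>n. 1 \<le> n \<Longrightarrow> 0 < a n"
    and a_lim: "filterlim a at_top sequentially"
    and c_pos: "0 < c"
    and a_bound: "\<And>n. 1 \<le> n \<Longrightarrow>
          c * (real (a n) - 2 ^ floor_log (a n)) * ln (real (a n)) \<le> norlund_weight q (a n)"
    and f_L1: "integrable dyadic_haar f"
  shows "AE x in dyadic_haar. (\<lambda>n. norlund_mean q f (a n) x) \<longlonglongrightarrow> f x"
proof -
  define m where "m n = floor_log (a n)" for n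
  define r where "r n = a n - 2 ^ m n" for n
  define Q where "Q n = norlund_weight q (a n)" for n
  \<comment> \<open>The summation matrix: the entry 1 at i = m n stands for the separate term A m of
    \<open>norm_norlund_mean_diff_le\<close>, and rows are padded with 0 beyond it.\<close>
  define \<beta> where "\<beta> n i = (if i = m n then 1 else if i < m n
    then (2 * 2 ^ i * q (r n + 2 ^ i) + q 0 * real (r n)) / Q n else 0)" for n i
  have a_eq: "a n = 2 ^ m n + r n" "r n < 2 ^ m n" if "1 \<le> n" for n
    using floor_log_exp2_le[of "a n"] floor_log_exp2_gt[of "a n"] a_pos[OF that]
    by (auto simp: m_def r_def)
  have Q_pos: "0 < Q n" if "1 \<le> n" for n
    using a_pos[OF that] q0 q_nonneg unfolding Q_def norlund_weight_def
    by (intro sum_pos2[of _ 0]) auto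
  \<comment> \<open>This includes n = 0, where a 0 may be 0; nonnegativity of the matrix is wanted
    for all rows.\<close>
  have Q_nonneg: "0 \<le> Q n" for n
    using q_nonneg unfolding Q_def norlund_weight_def by (intro sum_nonneg) auto
  have q_le: "q k \<le> q 0" for k
    by (rule lift_Suc_antimono_le[of q]) (use q_noninc in auto)
  have m_top: "filterlim m at_top sequentially"
    unfolding filterlim_at_top
  proof
    fix Z
    have "eventually (\<lambda>n. 2 ^ Z \<le> a n) sequentially"
      using a_lim unfolding filterlim_at_top by blast
    then show "eventually (\<lambda>n. Z \<le> m n) sequentially"
      by eventually_elim (metis floor_log_le_iff floor_log_power m_def)
  qed
  have Q_top: "filterlim Q at_top sequentially"
    unfolding Q_def by (rule filterlim_compose[OF Q_lim a_lim])
  \<comment> \<open>The growth hypothesis in usable form: r n is the excess of a n over its leading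
    power of 2, and ln (a n) >= m n * ln 2.\<close>
  have rm: "real (m n) * real (r n) \<le> Q n / (c * ln 2)" if "1 \<le> n" for n
  proof -
    have "real (2 ^ m n) \<le> real (a n)"
      using a_eq(1)[OF that] unfolding of_nat_le_iff by simp
    then have "ln (2 ^ m n) \<le> ln (real (a n))"
      by (intro ln_mono) auto
    then have "real (m n) * ln 2 \<le> ln (real (a n))" by (simp add: ln_realpow)
    then have "c * real (r n) * (real (m n) * ln 2) \<le> c * real (r n) * ln (real (a n))"
      using c_pos by (intro mult_left_mono) auto
    also have "\<dots> \<le> Q n"
    proof -
      have "real (a n) - 2 ^ floor_log (a n) = real (r n)"
        using arg_cong[OF a_eq(1)[OF that], of real] by (simp add: m_def)
      then show ?thesis using a_bound[OF that] by (simp only: Q_def)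
    qed
    finally show ?thesis using c_pos by (simp add: field_simps)
  qed
  have \<beta>_nonneg: "0 \<le> \<beta> n i" for n i
    using q_nonneg Q_nonneg by (simp add: \<beta>_def)
  have \<beta>_lim: "(\<lambda>n. \<beta> n i) \<longlonglongrightarrow> 0" for i
  proof (rule tendsto_sandwich[OF _ _ tendsto_const])
    \<comment> \<open>For fixed i the first part of the entry is O(1 / Q n) because q <= q 0, and
      the second is O(1 / m n) by \<open>rm\<close>.\<close>
    have "(\<lambda>n. (2 * 2 ^ i * q 0) / Q n + q 0 / (c * ln 2) / real (m n)) \<longlonglongrightarrow> 0 + 0"
      by (intro tendsto_add tendsto_divide_0[OF tendsto_const] filterlim_at_top_imp_at_infinity Q_top
          filterlim_compose[OF filterlim_real_sequentially m_top])
    then show "(\<lambda>n. (2 * 2 ^ i * q 0) / Q n + q 0 / (c * ln 2) / real (m n)) \<longlonglongrightarrow> 0" by simp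
    \<comment> \<open>The entry 1 sits in column m n, which eventually leaves every fixed column
      behind; it also follows that m n > 0 when \<open>rm\<close> is divided by it.\<close>
    have "eventually (\<lambda>n. Suc i \<le> m n) sequentially"
      using m_top unfolding filterlim_at_top by blast
    then show "eventually (\<lambda>n. \<beta> n i \<le> (2 * 2 ^ i * q 0) / Q n + q 0 / (c * ln 2) / real (m n)) sequentially"
      using eventually_ge_at_top[of 1]
    proof eventually_elim
      case (elim n)
      have "\<beta> n i = 2 * 2 ^ i * q (r n + 2 ^ i) / Q n + q 0 * (real (r n) / Q n)"
        using elim by (simp add: \<beta>_def add_divide_distrib)
      also have "\<dots> \<le> 2 * 2 ^ i * q 0 / Q n + q 0 * (1 / (c * ln 2) / real (m n))"
      proof (intro add_mono divide_right_mono mult_left_mono q_le Q_nonneg)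
        show "real (r n) / Q n \<le> 1 / (c * ln 2) / real (m n)"
          using rm[OF elim(2)] Q_pos[OF elim(2)] elim(1) c_pos by (simp add: field_simps)
      qed (use q0 in auto)
      finally show ?case by simp
    qed
  qed (auto simp: \<beta>_nonneg)
  \<comment> \<open>The 5 is 4 from \<open>flip_coefficients_sum_le\<close> plus the entry 1; the m
    n equal summands with q 0 * r n are bounded together by \<open>rm\<close>.\<close>
  have \<beta>_sum: "(\<Sum>i<Suc (m n). \<beta> n i) \<le> 5 + q 0 / (c * ln 2)" if "1 \<le> n" for n
  proof -
    have "(\<Sum>i<Suc (m n). \<beta> n i)
        = (\<Sum>i<m n. (2 * 2 ^ i * q (r n + 2 ^ i) + q 0 * real (r n)) / Q n) + 1"
      by (simp add: \<beta>_def)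
    also have "(\<Sum>i<m n. (2 * 2 ^ i * q (r n + 2 ^ i) + q 0 * real (r n)) / Q n)
        = (\<Sum>i<m n. 2 * 2 ^ i * q (r n + 2 ^ i)) / Q n + q 0 * ((real (m n) * real (r n)) / Q n)"
      by (simp add: sum_divide_distrib[symmetric] sum.distrib add_divide_distrib)
    also have "\<dots> \<le> 4 + q 0 * (1 / (c * ln 2))"
    proof (intro add_mono mult_left_mono)
      show "(\<Sum>i<m n. 2 * 2 ^ i * q (r n + 2 ^ i)) / Q n \<le> 4"
        using flip_coefficients_sum_le[OF a_eq(1)[OF that], of q] q_nonneg q_noninc Q_pos[OF that]
        by (simp add: Q_def divide_le_eq)
      show "real (m n) * real (r n) / Q n \<le> 1 / (c * ln 2)"
        using rm[OF that] Q_pos[OF that] by (simp add: divide_le_eq)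
    qed (use q0 in auto)
    finally show ?thesis by simp
  qed
  show ?thesis
    using AE_flip_lebesgue_point[OF f_L1]
  proof (rule eventually_mono)
    fix x assume "flip_lebesgue_point f x"
    define A where "A i = (\<integral>y. norm (f y - f x) * flip_kernel i (bit_add x y) \<partial>dyadic_haar)" for i
    have A: "A \<longlonglongrightarrow> 0"
      unfolding A_def by (rule flip_lebesgue_point_integral_tendsto) fact+
    have A_nonneg: "0 \<le> A i" for i
      unfolding A_def by (intro integral_nonneg_AE) (simp add: flip_kernel_nonneg)
    have lim: "(\<lambda>n. \<Sum>i<Suc (m n). \<beta> n i * \<bar>A i\<bar>) \<longlonglongrightarrow> 0"
      by (rule tendsto_weighted_sum_0[OF A \<beta>_lim \<beta>_nonneg eventually_sequentiallyI]) (rule \<beta>_sum)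
    have "norm (norlund_mean q f (a n) x - f x) \<le> (\<Sum>i<Suc (m n). \<beta> n i * \<bar>A i\<bar>)" if "1 \<le> n" for n
    proof -
      have "norm (norlund_mean q f (a n) x - f x)
        \<le> A (m n) + (\<Sum>i<m n. (2 * 2 ^ i * q (r n + 2 ^ i) + q 0 * real (r n)) / norlund_weight q (a n) * A i)"
        unfolding A_def
        by (rule norm_norlund_mean_diff_le[OF f_L1 a_eq(2,1)[OF that]])
          (use Q_pos[OF that] in \<open>simp_all add: Q_def q_nonneg q_noninc\<close>)
      also have "\<dots> = (\<Sum>i<Suc (m n). \<beta> n i * \<bar>A i\<bar>)"
        using A_nonneg by (simp add: \<beta>_def Q_def)
      finally show ?thesis .
    qed
    then have "(\<lambda>n. norlund_mean q f (a n) x - f x) \<longlonglongrightarrow> 0"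
      by (intro Lim_null_comparison[OF eventually_sequentiallyI lim])
    then show "(\<lambda>n. norlund_mean q f (a n) x) \<longlonglongrightarrow> f x"
      by (rule LIM_zero_cancel)
  qed
qed

end
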